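(* Let $n\ge 1$ be an integer, $0<\alpha<1$, and $\kappa_{n,\alpha}=\omega_n^{\frac{n-\alpha}{n}}\big(2P_\alpha(\mathbb B^n)\big)^{-1}$. The following three optimal statements are equivalent (where "optimal" means that the statement holds and that the constant, $\kappa_{n,\alpha}$ in (i) and (ii), $2\kappa_{n,\alpha}$ in (iii), cannot be replaced by any smaller one): (i) The fractional Sobolev inequality $\|f\|_{L^{\frac{n}{n-\alpha}}}\le \kappa_{n,\alpha}\|f\|_{\dot{\Lambda}_\alpha^{1,1}}$ holds for every $f\in C_0^\infty$. (ii) The fractional isocapacitary inequality $\big(V(O)\big)^{\frac{n-\alpha}{n}}\le \kappa_{n,\alpha}\,\mathrm{cap}(\overline{O};\dot{\Lambda}_\alpha^{1,1})$ holds for every bounded domain $O\subset\mathbb R^n$ with $C^\infty$ boundary $\partial O$. (iii) The fractional isoperimetric inequality $\big(V(O)\big)^{\frac{n-\alpha}{n}}\le 2\kappa_{n,\alpha}P_\alpha(O)$ holds for every bounded domain $O\subset\mathbb R^n$ with $C^\infty$ boundary $\partial O$.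
   Context: $C_0^\infty$ is the class of all smooth (real-valued) functions with compact support in $\mathbb R^n$, and $1_E$ is the indicator function of a set $E\subset\mathbb R^n$. $V$ denotes Lebesgue measure (volume) on $\mathbb R^n$, $\mathbb B^n$ is the unit ball of $\mathbb R^n$, and $\omega_n=V(\mathbb B^n)$. For $f\in C_0^\infty$, $$\|f\|_{\dot{\Lambda}_\alpha^{1,1}}=\int_{\mathbb R^n}\left(\int_{\mathbb R^n}|f(x+h)-f(x)|\,dx\right)\frac{dh}{|h|^{n+\alpha}}.$$ The fractional Sobolev capacity of a compact set $K\subset\mathbb R^n$ is $$\mathrm{cap}(K;\dot{\Lambda}_\alpha^{1,1})=\inf\big\{\|f\|_{\dot{\Lambda}_\alpha^{1,1}}:\ f\in C_0^\infty,\ f\ge 1_K\big\}.$$ The fractional $\alpha$-perimeter of a (measurable) set $E\subset\mathbb R^n$, with $E^c=\mathbb R^n\setminus E$, is $$P_\alpha(E)=\int_E\int_{E^c}\frac{dx\,dy}{|x-y|^{n+\alpha}}.$$ A domain is a connected open set, and $\overline O$ is the closure of $O$. *)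

theory Defs
  imports "HOL-Analysis.Analysis"
begin

(* Continuous differentiability of order k on a set S, used for open S only. *)
primrec Ck_on :: "nat \<Rightarrow> ('a::real_normed_vector \<Rightarrow> 'b::real_normed_vector) \<Rightarrow> 'a set \<Rightarrow> bool" where
  "Ck_on 0 f S \<longleftrightarrow> continuous_on S f"
| "Ck_on (Suc k) f S \<longleftrightarrow> (\<forall>x\<in>S. f differentiable (at x)) \<and>
     (\<forall>v. Ck_on k (\<lambda>x. frechet_derivative f (at x) v) S)"

definition smooth_on :: "('a::real_normed_vector \<Rightarrow> 'b::real_normed_vector) \<Rightarrow> 'a set \<Rightarrow> bool" where
  "smooth_on f S \<longleftrightarrow> (\<forall>k. Ck_on k f S)"

definition test_functions :: "(real^'n \<Rightarrow> real) set" where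
  "test_functions = {f. smooth_on f UNIV \<and> compact (closure {x. f x \<noteq> 0})}"

definition Lp_norm :: "real \<Rightarrow> (real^'n \<Rightarrow> real) \<Rightarrow> real" where
  "Lp_norm p f = (LINT x|lebesgue. \<bar>f x\<bar> powr p) powr (1 / p)"

definition frac_seminorm :: "real \<Rightarrow> (real^'n \<Rightarrow> real) \<Rightarrow> ennreal" where
  "frac_seminorm \<alpha> f =
     (\<integral>\<^sup>+ h. (\<integral>\<^sup>+ x. ennreal \<bar>f (x + h) - f x\<bar> \<partial>lebesgue) / ennreal (norm h powr (real CARD('n) + \<alpha>)) \<partial>lebesgue)"

definition frac_capacity :: "real \<Rightarrow> (real^'n) set \<Rightarrow> ennreal" where
  "frac_capacity \<alpha> K = Inf {frac_seminorm \<alpha> f | f. f \<in> test_functions \<and> (\<forall>x. f x \<ge> indicator K x)}"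

definition frac_perimeter :: "real \<Rightarrow> (real^'n) set \<Rightarrow> ennreal" where
  "frac_perimeter \<alpha> E =
     (\<integral>\<^sup>+ x\<in>E. (\<integral>\<^sup>+ y\<in>-E. ennreal (1 / norm (x - y) powr (real CARD('n) + \<alpha>)) \<partial>lebesgue) \<partial>lebesgue)"

(* The boundary is locally a regular level set of a smooth defining function, with U on one side
   of it.  Since the derivative of g does not vanish, the frontier of U in the ball is {g = 0}. *)
definition smooth_boundary :: "(real^'n) set \<Rightarrow> bool" where
  "smooth_boundary U \<longleftrightarrow>
     (\<forall>p\<in>frontier U. \<exists>r>0. \<exists>g :: real^'n \<Rightarrow> real.
        smooth_on g (ball p r) \<and>
        (\<forall>x\<in>ball p r. frechet_derivative g (at x) \<noteq> (\<lambda>v. 0)) \<and>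
        U \<inter> ball p r = {x \<in> ball p r. g x < 0})"

definition smooth_domains :: "(real^'n) set set" where
  "smooth_domains = {U. open U \<and> connected U \<and> bounded U \<and> smooth_boundary U}"

definition kappa :: "'n::finite itself \<Rightarrow> real \<Rightarrow> ennreal" where
  "kappa _ \<alpha> =
     ennreal (measure lebesgue (ball 0 1 :: (real^'n) set) powr ((real CARD('n) - \<alpha>) / real CARD('n)))
       / (2 * frac_perimeter \<alpha> (ball 0 1 :: (real^'n) set))"

definition optimal_constant :: "(ennreal \<Rightarrow> bool) \<Rightarrow> ennreal \<Rightarrow> bool" where
  "optimal_constant P c \<longleftrightarrow> P c \<and> (\<forall>c'<c. \<not> P c')"

definition sobolev_ineq :: "'n::finite itself \<Rightarrow> real \<Rightarrow> ennreal \<Rightarrow> bool" where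
  "sobolev_ineq _ \<alpha> c \<longleftrightarrow>
     (\<forall>f \<in> (test_functions :: (real^'n \<Rightarrow> real) set).
        ennreal (Lp_norm (real CARD('n) / (real CARD('n) - \<alpha>)) f) \<le> c * frac_seminorm \<alpha> f)"

definition isocapacitary_ineq :: "'n::finite itself \<Rightarrow> real \<Rightarrow> ennreal \<Rightarrow> bool" where
  "isocapacitary_ineq _ \<alpha> c \<longleftrightarrow>
     (\<forall>U \<in> (smooth_domains :: (real^'n) set set).
        ennreal (measure lebesgue U powr ((real CARD('n) - \<alpha>) / real CARD('n)))
          \<le> c * frac_capacity \<alpha> (closure U))"

definition isoperimetric_ineq :: "'n::finite itself \<Rightarrow> real \<Rightarrow> ennreal \<Rightarrow> bool" where
  "isoperimetric_ineq _ \<alpha> c \<longleftrightarrow>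
     (\<forall>U \<in> (smooth_domains :: (real^'n) set set).
        ennreal (measure lebesgue U powr ((real CARD('n) - \<alpha>) / real CARD('n)))
          \<le> c * frac_perimeter \<alpha> U)"

end

theory Submission
  imports Defs
begin

text \<open>
  All three optimality statements are true, which gives the equivalences.

  Polarization with respect to a hyperplane does not increase \<open>P\<^sub>\<alpha>\<close>.  Averaging over all hyperplanes
  shows that a subset of a fixed ball that has the same volume as a ball \<open>B\<close> around \<open>0\<close> and differs from \<open>B\<close>
  by at least \<open>\<delta>\<close> in volume has a polarization whose intersection with \<open>B\<close> is larger by an amount that
  depends on \<open>\<delta>\<close>, not on the set.  Hence finitely
  many polarizations bring a bounded set \<open>E\<close> arbitrarily close to \<open>B\<close>, and lower semicontinuity gives
  \<open>P\<^sub>\<alpha> (B) \<le> P\<^sub>\<alpha> (E)\<close>: this is (iii) for every bounded Borel set, with equality for balls.  The coarea formula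
  and Hoelder's inequality on the level sets turn it into (i), and (ii) follows by testing (i).  The constants
  in (i) and (ii) are sharp because the unit ball is approximated by smooth radial bumps, whose level sets
  are balls.
\<close>

subsection \<open>Reflections and Lebesgue measure\<close>

text \<open>Polarization is convenient here because folding both integrals along the mirror reduces
  the comparison of perimeters to finitely many membership patterns of four points. The delicate
  point is a gain that does not shrink along the iteration. A mirror is encoded by the image
  \<open>a\<close> of \<open>0\<close>. For a fixed missing point \<open>x\<close>, the mirrors that
  send it to a surplus point form a set of parameters whose volume is bounded below by a Lipschitz
  estimate, and Fubini then yields one mirror that serves many \<open>x\<close> at once. The
  estimate degenerates as \<open>a\<close> tends to \<open>0\<close>, hence a thin shell of the ball
  is discarded. The limit is taken at each fixed translation \<open>h\<close>, where only volumes
  occur and the singular kernel is a mere factor. The comparison is made for all bounded Borel sets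
  because level sets of test functions can be irregular. The factor 2 between the constants arises
  since the seminorm of an indicator counts each pair inside/outside in both orders.\<close>

lemma nn_integral_lborel_translate:
  fixes f :: "'a::euclidean_space \<Rightarrow> ennreal"
  assumes [measurable]: "f \<in> borel_measurable borel"
  shows "(\<integral>\<^sup>+x. f (x + c) \<partial>lborel) = (\<integral>\<^sup>+x. f x \<partial>lborel)"
proof -
  have "(\<integral>\<^sup>+x. f x \<partial>lborel) = (\<integral>\<^sup>+x. f x \<partial>distr lborel borel ((+) c))"
    by (simp add: lborel_distr_plus)
  also have "\<dots> = (\<integral>\<^sup>+x. f (c + x) \<partial>lborel)"
    by (subst nn_integral_distr) auto
  finally show ?thesis by (simp add: add.commute)
qed

lemma nn_integral_lborel_scale:
  fixes f :: "'a::euclidean_space \<Rightarrow> ennreal"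
  assumes [measurable]: "f \<in> borel_measurable borel" and c: "c \<noteq> 0"
  shows "(\<integral>\<^sup>+x. f x \<partial>lborel) = ennreal (\<bar>c\<bar> ^ DIM('a)) * (\<integral>\<^sup>+x. f (c *\<^sub>R x) \<partial>lborel)"
  by (subst lborel_affine[OF c, of 0])
     (simp add: nn_integral_density nn_integral_distr nn_integral_cmult)

lemma nn_integral_lborel_uminus:
  fixes f :: "'a::euclidean_space \<Rightarrow> ennreal"
  assumes [measurable]: "f \<in> borel_measurable borel"
  shows "(\<integral>\<^sup>+x. f (- x) \<partial>lborel) = (\<integral>\<^sup>+x. f x \<partial>lborel)"
  using nn_integral_lborel_scale[of f "-1"] by simp

text \<open>
  The library has this for index types with a well-order only.  The proof is the uniqueness of
  Haar measure: evaluate \<open>\<integral>\<integral> 1\<^sub>B (T x) 1\<^sub>C (y)\<close> in two ways, where \<open>C\<close> is the unit ball.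
\<close>
lemma emeasure_linear_isometry_vimage:
  fixes T :: "'a::euclidean_space \<Rightarrow> 'a"
  assumes T: "linear T" and iso: "\<And>x. norm (T x) = norm x" and B: "B \<in> sets borel"
  shows "emeasure lborel (T -` B) = emeasure lborel B"
proof -
  have [measurable]: "T \<in> borel_measurable borel"
    by (intro borel_measurable_continuous_onI linear_continuous_on linear_conv_bounded_linear[THEN iffD1] T)
  note [measurable] = B
  have "inj T"
    by (simp add: linear_injective_0[OF T]) (metis iso norm_eq_zero)
  then have "surj T" using linear_injective_imp_surjective[OF T] by simp
  define C where "C = ball (0::'a) 1"
  have [measurable]: "C \<in> sets borel" by (simp add: C_def)
  define b c where "b = (indicator B :: 'a \<Rightarrow> ennreal)" and "c = (indicator C :: 'a \<Rightarrow> ennreal)"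
  have [measurable]: "b \<in> borel_measurable borel" "c \<in> borel_measurable borel"
    by (simp_all add: b_def c_def)
  have eB: "emeasure lborel B = (\<integral>\<^sup>+x. b x \<partial>lborel)" and eC: "emeasure lborel C = (\<integral>\<^sup>+x. c x \<partial>lborel)"
    by (simp_all add: b_def c_def)
  have "T -` B \<inter> space borel \<in> sets borel" by (rule measurable_sets[OF _ B]) measurable
  then have eTB: "emeasure lborel (T -` B) = (\<integral>\<^sup>+x. b (T x) \<partial>lborel)"
    by (simp add: b_def indicator_vimage[symmetric] flip: nn_integral_indicator)
  have "emeasure lborel (T -` B) * emeasure lborel C = (\<integral>\<^sup>+x. \<integral>\<^sup>+y. b (T x) * c y \<partial>lborel \<partial>lborel)"
    unfolding eTB eC by (simp add: nn_integral_cmult nn_integral_multc)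
  also have "\<dots> = (\<integral>\<^sup>+x. \<integral>\<^sup>+y. b (T x) * c (y - T x) \<partial>lborel \<partial>lborel)"
  proof (rule nn_integral_cong)
    fix x :: 'a
    show "(\<integral>\<^sup>+y. b (T x) * c y \<partial>lborel) = (\<integral>\<^sup>+y. b (T x) * c (y - T x) \<partial>lborel)"
      using nn_integral_lborel_translate[of "\<lambda>y. b (T x) * c y" "- T x"] by simp
  qed
  also have "\<dots> = (\<integral>\<^sup>+y. \<integral>\<^sup>+x. b (T x) * c (y - T x) \<partial>lborel \<partial>lborel)"
    by (rule lborel_pair.Fubini') simp
  also have "\<dots> = (\<integral>\<^sup>+y. \<integral>\<^sup>+x. b (T x + y) * c (- T x) \<partial>lborel \<partial>lborel)"
  proof (rule nn_integral_cong)
    fix y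
    obtain z where z: "y = T z" using \<open>surj T\<close> by auto
    show "(\<integral>\<^sup>+x. b (T x) * c (y - T x) \<partial>lborel) = (\<integral>\<^sup>+x. b (T x + y) * c (- T x) \<partial>lborel)"
      by (subst nn_integral_lborel_translate[of "\<lambda>x. b (T x) * c (y - T x)" z, symmetric])
        (simp_all add: z linear_add[OF T])
  qed
  also have "\<dots> = (\<integral>\<^sup>+x. \<integral>\<^sup>+y. b (T x + y) * c (- T x) \<partial>lborel \<partial>lborel)"
    by (rule lborel_pair.Fubini'[symmetric]) simp
  also have "\<dots> = (\<integral>\<^sup>+x. \<integral>\<^sup>+y. b y * c x \<partial>lborel \<partial>lborel)"
  proof (rule nn_integral_cong)
    fix x :: 'a
    have "c (- T x) = c x" by (simp add: c_def C_def indicator_def iso)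
    then show "(\<integral>\<^sup>+y. b (T x + y) * c (- T x) \<partial>lborel) = (\<integral>\<^sup>+y. b y * c x \<partial>lborel)"
      using nn_integral_lborel_translate[of "\<lambda>y. b y * c x" "T x"] by (simp add: add.commute)
  qed
  also have "\<dots> = emeasure lborel B * emeasure lborel C"
    unfolding eB eC by (simp add: nn_integral_cmult nn_integral_multc)
  finally have eq: "emeasure lborel (T -` B) * emeasure lborel C = emeasure lborel B * emeasure lborel C" .
  have "emeasure lborel C = ennreal (measure lborel C)" "measure lborel C > 0"
    by (simp_all add: C_def emeasure_ball content_ball)
  with eq show ?thesis
    by (simp add: mult_right_ennreal_cancel)
qed

text \<open>The reflection in the hyperplane that bisects \<open>0\<close> and \<open>a\<close>; meaningful for \<open>a \<noteq> 0\<close> only.\<close>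
definition reflect :: "'a::real_inner \<Rightarrow> 'a \<Rightarrow> 'a" where
  "reflect a x = x + a - (2 * (x \<bullet> a) / (a \<bullet> a)) *\<^sub>R a"

text \<open>These are the points closer to \<open>0\<close> than to \<open>a\<close>, so putting
  mass on this side moves it towards the origin.\<close>

definition near_side :: "'a::real_inner \<Rightarrow> 'a set" where
  "near_side a = {x. 2 * (x \<bullet> a) < a \<bullet> a}"

lemma reflect_inner: "a \<noteq> 0 \<Longrightarrow> reflect a x \<bullet> a = a \<bullet> a - x \<bullet> a"
  by (simp add: reflect_def inner_diff_left inner_add_left)

lemma reflect_reflect [simp]: "a \<noteq> 0 \<Longrightarrow> reflect a (reflect a x) = x"
proof -
  assume a: "a \<noteq> 0"
  have "2 * (reflect a x \<bullet> a) / (a \<bullet> a) = 2 - 2 * (x \<bullet> a) / (a \<bullet> a)"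
    using a by (simp add: reflect_inner[OF a] diff_divide_distrib)
  then have "reflect a (reflect a x) = reflect a x + a - (2 - 2 * (x \<bullet> a) / (a \<bullet> a)) *\<^sub>R a"
    by (simp add: reflect_def[of a "reflect a x"])
  also have "\<dots> = x" by (simp add: reflect_def scaleR_diff_left scaleR_2)
  finally show "reflect a (reflect a x) = x" .
qed

lemma dist_reflect_reflect [simp]:
  assumes "a \<noteq> 0" shows "norm (reflect a x - reflect a y) = norm (x - y)"
proof -
  have "norm (reflect a x - reflect a y) ^ 2 = norm (x - y) ^ 2"
    using assms unfolding power2_norm_eq_inner reflect_def
    by (simp add: inner_diff_left inner_diff_right inner_add_left inner_add_right inner_commute field_simps)
  then show ?thesis by simp
qed

lemma dist_reflect_swap:
  assumes "a \<noteq> 0" shows "norm (reflect a x - y) = norm (x - reflect a y)"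
  using dist_reflect_reflect[OF assms, of x "reflect a y"] assms by simp

text \<open>The last summand is four times the product of the signed distances of \<open>x\<close>
  and \<open>y\<close> to the mirror; its sign tells whether the two points lie on the same
  side.\<close>

lemma norm_diff_reflect_sq:
  assumes "a \<noteq> 0"
  shows "norm (x - reflect a y) ^ 2
    = norm (x - y) ^ 2 + (a \<bullet> a - 2 * (x \<bullet> a)) * (a \<bullet> a - 2 * (y \<bullet> a)) / (a \<bullet> a)"
  using assms unfolding power2_norm_eq_inner reflect_def
  by (simp add: inner_diff_left inner_diff_right inner_add_left inner_add_right inner_commute field_simps)

lemma norm_reflect_sq:
  assumes "a \<noteq> 0"
  shows "norm (reflect a y) ^ 2 = norm y ^ 2 + (a \<bullet> a - 2 * (y \<bullet> a))"
  using norm_diff_reflect_sq[OF assms, of 0 y] assms by simp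

lemma near_side_iff_norm: "a \<noteq> 0 \<Longrightarrow> x \<in> near_side a \<longleftrightarrow> norm x < norm (reflect a x)"
  using power_mono_iff[of "norm (reflect a x)" "norm x" 2]
  by (auto simp: norm_reflect_sq near_side_def)

lemma measurable_reflect [measurable]: "reflect (a::'a::euclidean_space) \<in> borel_measurable borel"
  unfolding reflect_def[abs_def] by measurable

lemma near_side_borel [measurable]: "near_side (a::'a::euclidean_space) \<in> sets borel"
  unfolding near_side_def by measurable

lemma nn_integral_lborel_reflect:
  fixes f :: "'a::euclidean_space \<Rightarrow> ennreal"
  assumes [measurable]: "f \<in> borel_measurable borel" and a: "a \<noteq> 0"
  shows "(\<integral>\<^sup>+x. f (reflect a x) \<partial>lborel) = (\<integral>\<^sup>+x. f x \<partial>lborel)"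
proof -
  \<comment> \<open>\<open>reflect a\<close> is affine and maps \<open>0\<close> to
    \<open>a\<close>; subtracting \<open>a\<close> leaves its linear part, to which invariance under
    linear isometries applies.\<close>
  define T where "T x = reflect a x - a" for x
  have T: "linear T"
    unfolding T_def reflect_def
    by (rule linearI) (simp_all add: inner_add_left inner_diff_left algebra_simps add_divide_distrib)
  have [measurable]: "T \<in> borel_measurable borel" unfolding T_def by measurable
  have "T x = reflect a x - reflect a 0" for x by (simp add: T_def reflect_def)
  then have iso: "norm (T x) = norm x" for x using dist_reflect_reflect[OF a, of x 0] by simp
  have dT: "distr lborel borel T = lborel"
    by (rule measure_eqI) (auto simp: emeasure_distr emeasure_linear_isometry_vimage[OF T iso])
  have "(\<integral>\<^sup>+x. f (reflect a x) \<partial>lborel) = (\<integral>\<^sup>+x. f (T x + a) \<partial>lborel)"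
    by (simp add: T_def)
  also have "\<dots> = (\<integral>\<^sup>+x. f (x + a) \<partial>distr lborel borel T)"
    by (subst nn_integral_distr) auto
  also have "\<dots> = (\<integral>\<^sup>+x. f x \<partial>lborel)"
    by (simp add: dT nn_integral_lborel_translate)
  finally show ?thesis .
qed

text \<open>The mirror is a null set and the far half is the image of the near half. Comparisons of
  integrals thus become pointwise comparisons on the pairs \<open>x\<close>,
  \<open>reflect a x\<close>.\<close>

lemma nn_integral_fold:
  fixes f :: "'a::euclidean_space \<Rightarrow> ennreal"
  assumes [measurable]: "f \<in> borel_measurable borel" and a: "a \<noteq> 0"
  shows "(\<integral>\<^sup>+x. f x \<partial>lborel) = (\<integral>\<^sup>+x. (f x + f (reflect a x)) * indicator (near_side a) x \<partial>lborel)"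
proof -
  let ?H = "near_side a"
  have "(\<integral>\<^sup>+x. f x \<partial>lborel) = (\<integral>\<^sup>+x. f x * indicator ?H x + f x * indicator ?H (reflect a x) \<partial>lborel)"
  proof (rule nn_integral_cong_AE)
    have "negligible {x. a \<bullet> x = a \<bullet> a / 2}"
      by (rule negligible_hyperplane) (simp add: a)
    then have "AE x in lborel. x \<notin> {x. a \<bullet> x = a \<bullet> a / 2}"
      by (intro AE_not_in) (auto simp: negligible_iff_null_sets null_sets_completion_iff closed_hyperplane)
    then show "AE x in lborel. f x = f x * indicator ?H x + f x * indicator ?H (reflect a x)"
    proof eventually_elim
      case (elim x)
      then have "2 * (x \<bullet> a) \<noteq> a \<bullet> a" by (simp add: inner_commute)
      then show ?case by (auto simp: near_side_def indicator_def reflect_inner[OF a])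
    qed
  qed
  also have "\<dots> = (\<integral>\<^sup>+x. f x * indicator ?H x \<partial>lborel) + (\<integral>\<^sup>+x. f x * indicator ?H (reflect a x) \<partial>lborel)"
    by (rule nn_integral_add) measurable
  also have "(\<integral>\<^sup>+x. f x * indicator ?H (reflect a x) \<partial>lborel) = (\<integral>\<^sup>+x. f (reflect a x) * indicator ?H x \<partial>lborel)"
    using nn_integral_lborel_reflect[OF _ a, of "\<lambda>x. f x * indicator ?H (reflect a x)"] a by simp
  also have "(\<integral>\<^sup>+x. f x * indicator ?H x \<partial>lborel) + \<dots> = (\<integral>\<^sup>+x. (f x + f (reflect a x)) * indicator ?H x \<partial>lborel)"
    by (subst nn_integral_add[symmetric]) (simp_all add: distrib_right)
  finally show ?thesis .
qed

subsection \<open>Fractional perimeter and polarization\<close>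

text \<open>Since \<open>inverse 0 = \<top>\<close> in \<open>ennreal\<close>, the kernel is antitone in \<open>norm z\<close> also at \<open>z = 0\<close>.\<close>
definition kern :: "real \<Rightarrow> 'a::euclidean_space \<Rightarrow> ennreal" where
  "kern s z = inverse (ennreal (norm z powr s))"

text \<open>The exponent is a free parameter: the comparison with balls is proved for every
  \<open>0 \<le> s\<close>, and \<open>s = n + \<alpha>\<close> enters with the sharp constant.
  Using \<open>lborel\<close> keeps all integrands Borel on the product, as Fubini requires.\<close>

definition per :: "real \<Rightarrow> 'a::euclidean_space set \<Rightarrow> ennreal" where
  "per s E = (\<integral>\<^sup>+x. \<integral>\<^sup>+y. indicator E x * indicator (- E) y * kern s (x - y) \<partial>lborel \<partial>lborel)"

text \<open>For \<open>E\<close> of finite measure this is the volume of \<open>E\<close> minus its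
  set covariogram at \<open>h\<close>.\<close>

definition exit_volume :: "'a::euclidean_space set \<Rightarrow> 'a \<Rightarrow> ennreal" where
  "exit_volume E h = emeasure lborel {x \<in> E. x + h \<notin> E}"

definition seminorm :: "real \<Rightarrow> ('a::euclidean_space \<Rightarrow> real) \<Rightarrow> ennreal" where
  "seminorm s f = (\<integral>\<^sup>+h. (\<integral>\<^sup>+x. ennreal \<bar>f (x + h) - f x\<bar> \<partial>lborel) * kern s h \<partial>lborel)"

lemma kern_minus [simp]: "kern s (- z) = kern s z"
  by (simp add: kern_def)

lemma kern_antimono: "0 \<le> s \<Longrightarrow> norm z \<le> norm w \<Longrightarrow> kern s w \<le> kern s z"
  unfolding kern_def
  by (cases "z = 0"; cases "w = 0") (auto simp: inverse_ennreal intro!: ennreal_leI le_imp_inverse_le powr_mono2)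

lemma measurable_kern [measurable]: "kern s \<in> borel_measurable borel"
  unfolding kern_def[abs_def] by measurable

lemma exit_volume_eq_nn_integral:
  assumes [measurable]: "E \<in> sets borel"
  shows "exit_volume E h = (\<integral>\<^sup>+x. indicator E x * indicator (- E) (x + h) \<partial>lborel)"
proof -
  have "exit_volume E h = (\<integral>\<^sup>+x. indicator {x \<in> E. x + h \<notin> E} x \<partial>lborel)"
    unfolding exit_volume_def by (subst nn_integral_indicator) measurable
  also have "\<dots> = (\<integral>\<^sup>+x. indicator E x * indicator (- E) (x + h) \<partial>lborel)"
    by (intro nn_integral_cong) (auto simp: indicator_def)
  finally show ?thesis .
qed

lemma measurable_exit_volume [measurable]:
  assumes [measurable]: "E \<in> sets borel"
  shows "exit_volume E \<in> borel_measurable borel"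
  unfolding exit_volume_eq_nn_integral[OF assms] by measurable

text \<open>Substituting \<open>y = x + h\<close> separates the singular kernel from a factor that
  varies little when \<open>E\<close> changes by a set of small measure. Both lower semicontinuity
  and finiteness for the ball rest on this form.\<close>

lemma per_eq_exit_volume:
  assumes [measurable]: "E \<in> sets borel"
  shows "per s E = (\<integral>\<^sup>+h. exit_volume E h * kern s h \<partial>lborel)"
proof -
  have "per s E = (\<integral>\<^sup>+x. \<integral>\<^sup>+h. indicator E x * indicator (- E) (x + h) * kern s h \<partial>lborel \<partial>lborel)"
    unfolding per_def
  proof (rule nn_integral_cong)
    fix x :: 'a
    show "(\<integral>\<^sup>+y. indicator E x * indicator (- E) y * kern s (x - y) \<partial>lborel)
      = (\<integral>\<^sup>+h. indicator E x * indicator (- E) (x + h) * kern s h \<partial>lborel)"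
      by (subst nn_integral_lborel_translate[of _ x, symmetric]) (simp_all add: add.commute)
  qed
  also have "\<dots> = (\<integral>\<^sup>+h. \<integral>\<^sup>+x. indicator E x * indicator (- E) (x + h) * kern s h \<partial>lborel \<partial>lborel)"
    by (rule lborel_pair.Fubini'[symmetric]) measurable
  also have "\<dots> = (\<integral>\<^sup>+h. exit_volume E h * kern s h \<partial>lborel)"
    unfolding exit_volume_eq_nn_integral[OF assms]
    by (intro nn_integral_cong nn_integral_multc) measurable
  finally show ?thesis .
qed

text \<open>The difference quotient sees points that leave \<open>E\<close> under \<open>h\<close>
  and points that enter it, and the latter leave under \<open>- h\<close>. This is the origin of the
  factor 2 between the Sobolev and the isoperimetric constant.\<close>

lemma seminorm_indicator:
  assumes [measurable]: "E \<in> sets borel"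
  shows "seminorm s (indicator E) = 2 * per s E"
proof -
  have "(\<integral>\<^sup>+x. ennreal \<bar>indicator E (x + h) - indicator E x\<bar> \<partial>lborel) = exit_volume E h + exit_volume E (- h)" for h
  proof -
    have "(\<integral>\<^sup>+x. ennreal \<bar>indicator E (x + h) - indicator E x\<bar> \<partial>lborel)
      = (\<integral>\<^sup>+x. indicator E x * indicator (- E) (x + h) + indicator E (x + h) * indicator (- E) x \<partial>lborel)"
      by (intro nn_integral_cong) (auto simp: indicator_def)
    also have "\<dots> = exit_volume E h + (\<integral>\<^sup>+x. indicator E (x + h) * indicator (- E) x \<partial>lborel)"
      by (subst nn_integral_add) (auto simp: exit_volume_eq_nn_integral)
    also have "(\<integral>\<^sup>+x. indicator E (x + h) * indicator (- E) x \<partial>lborel) = exit_volume E (- h)"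
      using nn_integral_lborel_translate[of "\<lambda>x. indicator E x * indicator (- E) (x - h)" h]
      by (simp add: exit_volume_eq_nn_integral)
    finally show ?thesis .
  qed
  then have "seminorm s (indicator E) = (\<integral>\<^sup>+h. exit_volume E h * kern s h + exit_volume E (- h) * kern s h \<partial>lborel)"
    by (simp add: seminorm_def distrib_right)
  also have "\<dots> = per s E + (\<integral>\<^sup>+h. exit_volume E (- h) * kern s h \<partial>lborel)"
    by (subst nn_integral_add) (auto simp: per_eq_exit_volume)
  also have "(\<integral>\<^sup>+h. exit_volume E (- h) * kern s h \<partial>lborel) = per s E"
    using nn_integral_lborel_uminus[of "\<lambda>h. exit_volume E h * kern s h"]
    by (simp add: per_eq_exit_volume)
  finally show ?thesis by (simp add: mult_2)
qed

text \<open>This is the two-point rearrangement: every pair \<open>x\<close>,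
  \<open>reflect a x\<close> keeps its number of points in the set, and a single one is placed on
  the near side.\<close>

definition polarize :: "'a::real_inner \<Rightarrow> 'a set \<Rightarrow> 'a set" where
  "polarize a E = (E \<inter> reflect a -` E) \<union> (E \<union> reflect a -` E) \<inter> near_side a"

lemma polarize_borel [measurable]:
  fixes E :: "'a::euclidean_space set"
  assumes "E \<in> sets borel" shows "polarize a E \<in> sets borel"
proof -
  have [measurable]: "reflect a -` E \<in> sets borel"
    using measurable_sets[OF measurable_reflect assms, of a] by simp
  show ?thesis unfolding polarize_def using assms by measurable
qed

lemma reflect_notin_near_side: "a \<noteq> 0 \<Longrightarrow> x \<in> near_side a \<Longrightarrow> reflect a x \<notin> near_side a"
  by (simp add: near_side_def reflect_inner)

lemma mem_polarize_near:
  assumes "x \<in> near_side a" shows "x \<in> polarize a E \<longleftrightarrow> x \<in> E \<or> reflect a x \<in> E"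
  using assms by (auto simp: polarize_def)

lemma mem_polarize_far:
  assumes "a \<noteq> 0" "x \<in> near_side a" shows "reflect a x \<in> polarize a E \<longleftrightarrow> x \<in> E \<and> reflect a x \<in> E"
  using assms reflect_notin_near_side[OF assms] by (auto simp: polarize_def)

lemma emeasure_polarize:
  fixes E :: "'a::euclidean_space set"
  assumes [measurable]: "E \<in> sets borel" and a: "a \<noteq> 0"
  shows "emeasure lborel (polarize a E) = emeasure lborel E"
proof -
  have "emeasure lborel F = (\<integral>\<^sup>+x. (indicator F x + indicator F (reflect a x)) * indicator (near_side a) x \<partial>lborel)"
    if [measurable]: "F \<in> sets borel" for F :: "'a set"
    by (subst nn_integral_fold[OF _ a, symmetric]) auto
  note * = this
  show ?thesis
    unfolding *[OF polarize_borel[OF assms(1)]] *[OF assms(1)]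
    by (intro nn_integral_cong)
       (auto simp: indicator_def mem_polarize_near mem_polarize_far[OF a])
qed

lemma nn_integral_fold2:
  fixes f :: "'a::euclidean_space \<Rightarrow> 'a \<Rightarrow> ennreal"
  assumes [measurable]: "case_prod f \<in> borel_measurable (borel \<Otimes>\<^sub>M borel)" and a: "a \<noteq> 0"
  shows "(\<integral>\<^sup>+x. \<integral>\<^sup>+y. f x y \<partial>lborel \<partial>lborel)
    = (\<integral>\<^sup>+x. (\<integral>\<^sup>+y. (f x y + f x (reflect a y) + (f (reflect a x) y + f (reflect a x) (reflect a y)))
         * indicator (near_side a) y \<partial>lborel) * indicator (near_side a) x \<partial>lborel)"
proof -
  have [measurable]: "f x \<in> borel_measurable borel" for x by measurable
  have "(\<integral>\<^sup>+x. \<integral>\<^sup>+y. f x y \<partial>lborel \<partial>lborel)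
    = (\<integral>\<^sup>+x. ((\<integral>\<^sup>+y. f x y \<partial>lborel) + (\<integral>\<^sup>+y. f (reflect a x) y \<partial>lborel)) * indicator (near_side a) x \<partial>lborel)"
    by (rule nn_integral_fold[OF _ a]) measurable
  also have "\<dots> = (\<integral>\<^sup>+x. (\<integral>\<^sup>+y. f x y + f (reflect a x) y \<partial>lborel) * indicator (near_side a) x \<partial>lborel)"
    by (intro nn_integral_cong arg_cong2[where f="(*)"] nn_integral_add[symmetric] refl) auto
  also have "\<dots> = (\<integral>\<^sup>+x. (\<integral>\<^sup>+y. (f x y + f x (reflect a y) + (f (reflect a x) y + f (reflect a x) (reflect a y)))
         * indicator (near_side a) y \<partial>lborel) * indicator (near_side a) x \<partial>lborel)"
  proof (rule nn_integral_cong, rule arg_cong2[where f="(*)", OF _ refl])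
    fix x
    show "(\<integral>\<^sup>+y. f x y + f (reflect a x) y \<partial>lborel)
      = (\<integral>\<^sup>+y. (f x y + f x (reflect a y) + (f (reflect a x) y + f (reflect a x) (reflect a y)))
         * indicator (near_side a) y \<partial>lborel)"
      by (subst nn_integral_fold[OF _ a]) (auto simp: add_ac)
  qed
  finally show ?thesis .
qed

lemma mult_indicator_mono:
  fixes u v :: ennreal
  shows "(x \<in> A \<Longrightarrow> u \<le> v) \<Longrightarrow> u * indicator A x \<le> v * indicator A x"
  by (auto simp: indicator_def)

text \<open>For near \<open>x\<close> and \<open>y\<close> the four pairs of points and mirror
  images have only two kernel values: \<open>?A\<close> on equal sides and the smaller
  \<open>?B\<close> on opposite sides. The contribution changes only if both mirror pairs meet
  \<open>E\<close> in one point each, on opposite sides; then \<open>?A\<close> is replaced by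
  \<open>?B\<close>.\<close>

lemma per_polarize:
  fixes E :: "'a::euclidean_space set"
  assumes [measurable]: "E \<in> sets borel" and a: "a \<noteq> 0" and s: "0 \<le> s"
  shows "per s (polarize a E) \<le> per s E"
proof -
  have "case_prod (\<lambda>x y. indicator F x * indicator (- F) y * kern s (x - y)) \<in> borel_measurable (borel \<Otimes>\<^sub>M borel)"
    if [measurable]: "F \<in> sets borel" for F :: "'a set" by measurable
  note fold = nn_integral_fold2[OF this a]
  show ?thesis
    unfolding per_def fold[OF polarize_borel[OF assms(1)]] fold[OF assms(1)]
  proof (intro nn_integral_mono mult_indicator_mono nn_integral_mono)
    fix x y :: 'a
    assume x: "x \<in> near_side a" and y: "y \<in> near_side a"
    let ?A = "kern s (x - y)" and ?B = "kern s (x - reflect a y)"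
    have eqs: "kern s (reflect a x - y) = ?B" "kern s (reflect a x - reflect a y) = ?A"
      using a by (simp_all add: kern_def dist_reflect_swap)
    have le: "?B \<le> ?A"
    proof (rule kern_antimono[OF s])
      have "norm (x - y) ^ 2 \<le> norm (x - reflect a y) ^ 2"
        using x y by (simp add: norm_diff_reflect_sq[OF a] near_side_def)
      then show "norm (x - y) \<le> norm (x - reflect a y)" by simp
    qed
    then have le2: "?B + ?B \<le> ?A + ?A"
      by (intro add_mono) auto
    show "(indicator (polarize a E) x * indicator (- polarize a E) y * kern s (x - y)
      + indicator (polarize a E) x * indicator (- polarize a E) (reflect a y) * kern s (x - reflect a y)
      + (indicator (polarize a E) (reflect a x) * indicator (- polarize a E) y * kern s (reflect a x - y)
      + indicator (polarize a E) (reflect a x) * indicator (- polarize a E) (reflect a y) * kern s (reflect a x - reflect a y)))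
      \<le> (indicator E x * indicator (- E) y * kern s (x - y)
      + indicator E x * indicator (- E) (reflect a y) * kern s (x - reflect a y)
      + (indicator E (reflect a x) * indicator (- E) y * kern s (reflect a x - y)
      + indicator E (reflect a x) * indicator (- E) (reflect a y) * kern s (reflect a x - reflect a y)))"
      using le le2 x y unfolding eqs
      by (cases "x \<in> E"; cases "reflect a x \<in> E"; cases "y \<in> E"; cases "reflect a y \<in> E")
         (simp_all add: mem_polarize_near mem_polarize_far[OF a] add.commute)

  qed
qed

text \<open>A centred ball that contains the far point of a mirror pair contains the near one too,
  so moving points to the near side never loses overlap with it. In the added set, \<open>x\<close>
  lies in the ball and its image outside, so \<open>x\<close> is near and is gained.\<close>

lemma polarize_gain:
  fixes E :: "'a::euclidean_space set"
  assumes E[measurable]: "E \<in> sets borel" and a: "a \<noteq> 0"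
  shows "emeasure lborel (E \<inter> ball 0 r) + emeasure lborel {x \<in> ball 0 r - E. reflect a x \<in> E - ball 0 r}
    \<le> emeasure lborel (polarize a E \<inter> ball 0 r)"
proof -
  let ?B = "ball (0::'a) r"
  let ?G = "{x \<in> ball 0 r - E. reflect a x \<in> E - ball 0 r}"
  note [measurable] = polarize_borel[OF E]
  have "?G = (?B - E) \<inter> reflect a -` (E - ?B)" by auto
  moreover have "reflect a -` (E - ?B) \<in> sets borel"
    using measurable_sets[OF measurable_reflect, of "E - ?B" a] by simp
  ultimately have [measurable]: "?G \<in> sets borel" by simp
  have fold: "emeasure lborel F = (\<integral>\<^sup>+x. (indicator F x + indicator F (reflect a x)) * indicator (near_side a) x \<partial>lborel)"
    if [measurable]: "F \<in> sets borel" for F :: "'a set"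
    by (subst nn_integral_fold[OF _ a, symmetric]) auto
  have ref [measurable]: "(\<lambda>x. indicator F (reflect a x) :: ennreal) \<in> borel_measurable borel"
    if "F \<in> sets borel" for F
    by (rule measurable_compose[OF measurable_reflect borel_measurable_indicator[OF that]])
  define u v :: "'a \<Rightarrow> ennreal"
    where "u x = (indicator (E \<inter> ?B) x + indicator (E \<inter> ?B) (reflect a x)) * indicator (near_side a) x"
      and "v x = (indicator ?G x + indicator ?G (reflect a x)) * indicator (near_side a) x" for x
  have "u \<in> borel_measurable borel" "v \<in> borel_measurable borel"
    unfolding u_def[abs_def] v_def[abs_def]
    by (intro borel_measurable_times_ennreal borel_measurable_add borel_measurable_indicator ref; simp)+
  then have "emeasure lborel (E \<inter> ?B) + emeasure lborel ?G = (\<integral>\<^sup>+x. u x + v x \<partial>lborel)"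
    unfolding u_def v_def by (subst nn_integral_add) (auto simp: fold)
  also have "\<dots> = (\<integral>\<^sup>+x. (indicator (E \<inter> ?B) x + indicator (E \<inter> ?B) (reflect a x)
          + (indicator ?G x + indicator ?G (reflect a x))) * indicator (near_side a) x \<partial>lborel)"
    by (simp add: u_def v_def distrib_right)
  also have "\<dots> \<le> (\<integral>\<^sup>+x. (indicator (polarize a E \<inter> ?B) x + indicator (polarize a E \<inter> ?B) (reflect a x))
      * indicator (near_side a) x \<partial>lborel)"
  proof (intro nn_integral_mono mult_indicator_mono)
    fix x assume x: "x \<in> near_side a"
    then have "norm x < norm (reflect a x)" by (simp add: near_side_iff_norm[OF a])
    then show "indicator (E \<inter> ?B) x + indicator (E \<inter> ?B) (reflect a x) + (indicator ?G x + indicator ?G (reflect a x))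
      \<le> (indicator (polarize a E \<inter> ?B) x + indicator (polarize a E \<inter> ?B) (reflect a x) :: ennreal)"
      using x a by (auto simp: indicator_def mem_polarize_near mem_polarize_far)
  qed
  also have "\<dots> = emeasure lborel (polarize a E \<inter> ?B)"
    by (subst fold) auto
  finally show ?thesis .
qed

lemma polarize_subset_cball:
  assumes a: "a \<noteq> 0" and E: "E \<subseteq> cball 0 R"
  shows "polarize a E \<subseteq> cball 0 R"
  using E near_side_iff_norm[OF a] unfolding polarize_def by force

text \<open>
  The library's change-of-variables bounds need a well-ordered index type; a Vitali covering by
  small balls gives the crude constant used here.
\<close>
lemma emeasure_lipschitz_image_le:
  fixes f :: "'a::euclidean_space \<Rightarrow> 'a"
  assumes S: "S \<in> sets borel" and L: "0 < L"
    and lip: "\<And>x y. x \<in> S \<Longrightarrow> y \<in> S \<Longrightarrow> norm (f x - f y) \<le> L * norm (x - y)"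
    and T: "T \<in> sets borel" "T \<subseteq> f ` S"
  shows "emeasure lborel T \<le> ennreal ((2 * L) ^ DIM('a)) * emeasure lborel S"
proof (rule ennreal_le_epsilon)
  fix e :: real assume "e > 0"
  define c where "c = (2 * L) ^ DIM('a)"
  have c: "c > 0" using L by (simp add: c_def)
  \<comment> \<open>The final estimate multiplies the excess of \<open>U\<close> over
    \<open>S\<close> by \<open>c\<close>, which turns \<open>e / c\<close> into
    \<open>e\<close>.\<close>
  obtain U where U: "open U" "S \<subseteq> U" "emeasure lborel (U - S) < ennreal (e / c)"
    using outer_regular_lborel[OF S, of "e / c"] \<open>e > 0\<close> c by auto
  \<comment> \<open>All balls centred in \<open>S\<close> and contained in \<open>U\<close> form a
    Vitali cover of \<open>S\<close>. A disjoint countable subfamily misses only a null part of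
    \<open>S\<close>, whose Lipschitz image \<open>N\<close> is null again; the volumes of the
    subfamily add up to at most that of \<open>U\<close>.\<close>
  define K where "K = {(x, r). x \<in> S \<and> 0 < r \<and> ball x r \<subseteq> U}"
  obtain C where C: "countable C" "C \<subseteq> K"
    "pairwise (\<lambda>i j. disjnt (ball (fst i) (snd i)) (ball (fst j) (snd j))) C"
    "negligible (S - (\<Union>i\<in>C. ball (fst i) (snd i)))"
  proof (rule Vitali_covering_theorem_balls[of S K fst snd])
    fix x and d :: real assume x: "x \<in> S" "0 < d"
    then obtain r where r: "r > 0" "ball x r \<subseteq> U" using U by (meson open_contains_ball subsetD)
    then have "(x, min r (d / 2)) \<in> K" using x by (auto simp: K_def)
    then show "\<exists>i. i \<in> K \<and> x \<in> ball (fst i) (snd i) \<and> snd i < d"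
      using x r by (intro exI[of _ "(x, min r (d / 2))"]) auto
  qed auto
  define N where "N = f ` (S - (\<Union>i\<in>C. ball (fst i) (snd i)))"
  have "negligible N"
    unfolding N_def
  proof (rule negligible_locally_Lipschitz_image[OF _ C(4)])
    fix x assume "x \<in> S - (\<Union>i\<in>C. ball (fst i) (snd i))"
    then show "\<exists>T B. open T \<and> x \<in> T \<and> (\<forall>y\<in>(S - (\<Union>i\<in>C. ball (fst i) (snd i))) \<inter> T. norm (f y - f x) \<le> B * norm (y - x))"
      using lip by (intro exI[of _ UNIV] exI[of _ L]) auto
  qed simp
  then have N: "N \<in> null_sets lebesgue" by (simp add: negligible_iff_null_sets)
  have Kb: "0 < snd i" "fst i \<in> S" "ball (fst i) (snd i) \<subseteq> U" if "i \<in> C" for i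
    using C(2) that unfolding K_def by (force, force, force)
  have "T \<subseteq> N \<union> (\<Union>i\<in>C. cball (f (fst i)) (L * snd i))"
  proof
    fix y assume "y \<in> T"
    then obtain x where x: "x \<in> S" "y = f x" using T by auto
    show "y \<in> N \<union> (\<Union>i\<in>C. cball (f (fst i)) (L * snd i))"
    proof (cases "x \<in> (\<Union>i\<in>C. ball (fst i) (snd i))")
      case True
      then obtain i where i: "i \<in> C" "norm (fst i - x) < snd i" by (auto simp: dist_norm)
      then have "norm (f (fst i) - f x) \<le> L * snd i"
        using lip[OF Kb(2)[OF i(1)] x(1)] L
        by (smt (verit) mult_left_mono)
      then show ?thesis using i x by (auto simp: dist_norm)
    qed (use x in \<open>auto simp: N_def\<close>)
  qed
  then have "emeasure lebesgue T \<le> emeasure lebesgue (N \<union> (\<Union>i\<in>C. cball (f (fst i)) (L * snd i)))"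
    using N C(1) by (intro emeasure_mono) (auto intro!: sets.Un sets.countable_UN'')
  also have "\<dots> \<le> emeasure lebesgue N + emeasure lebesgue (\<Union>i\<in>C. cball (f (fst i)) (L * snd i))"
    using N C(1) by (intro emeasure_subadditive) (auto intro!: sets.countable_UN'')
  also have "\<dots> = emeasure lebesgue (\<Union>i\<in>C. cball (f (fst i)) (L * snd i))"
    using N by auto
  also have "\<dots> \<le> (\<integral>\<^sup>+i. emeasure lebesgue (cball (f (fst i)) (L * snd i)) \<partial>count_space C)"
  proof -
    \<comment> \<open>Countable subadditivity over the index set \<open>C\<close>, written with
      counting measure so that no enumeration of \<open>C\<close> is chosen.\<close>
    have "emeasure lebesgue (\<Union>i\<in>C. cball (f (fst i)) (L * snd i))
      = (\<integral>\<^sup>+x. indicator (\<Union>i\<in>C. cball (f (fst i)) (L * snd i)) x \<partial>lebesgue)"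
      using C(1) by (subst nn_integral_indicator) (auto intro!: sets.countable_UN'')
    also have "\<dots> \<le> (\<integral>\<^sup>+x. \<integral>\<^sup>+i. indicator (cball (f (fst i)) (L * snd i)) x \<partial>count_space C \<partial>lebesgue)"
    proof (rule nn_integral_mono)
      fix x
      show "indicator (\<Union>i\<in>C. cball (f (fst i)) (L * snd i)) x
        \<le> (\<integral>\<^sup>+i. indicator (cball (f (fst i)) (L * snd i)) x \<partial>count_space C)"
      proof (cases "x \<in> (\<Union>i\<in>C. cball (f (fst i)) (L * snd i))")
        case True
        then obtain i where "i \<in> C" "x \<in> cball (f (fst i)) (L * snd i)" by auto
        then show ?thesis
          using nn_integral_ge_point[of i C "\<lambda>i. indicator (cball (f (fst i)) (L * snd i)) x"] True by simp
      qed simp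
    qed
    also have "\<dots> = (\<integral>\<^sup>+i. \<integral>\<^sup>+x. indicator (cball (f (fst i)) (L * snd i)) x \<partial>lebesgue \<partial>count_space C)"
      using C(1) by (intro nn_integral_count_space_nn_integral borel_measurable_indicator) auto
    finally show ?thesis by simp
  qed
  also have "\<dots> \<le> (\<integral>\<^sup>+i. ennreal c * emeasure lborel (ball (fst i) (snd i)) \<partial>count_space C)"
  proof (rule nn_integral_mono)
    fix i assume "i \<in> space (count_space C)"
    then have i: "i \<in> C" by simp
    have "unit_ball_vol (real DIM('a)) * (L * snd i) ^ DIM('a) \<le> c * (unit_ball_vol (real DIM('a)) * snd i ^ DIM('a))"
      using L Kb(1)[OF i] by (simp add: c_def power_mult_distrib field_simps)
    then show "emeasure lebesgue (cball (f (fst i)) (L * snd i)) \<le> ennreal c * emeasure lborel (ball (fst i) (snd i))"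
      using L Kb(1)[OF i] c
      by (simp add: emeasure_ball emeasure_cball ennreal_mult[symmetric] ennreal_leI)
  qed
  also have "\<dots> = ennreal c * (\<integral>\<^sup>+i. emeasure lborel (ball (fst i) (snd i)) \<partial>count_space C)"
    by (rule nn_integral_cmult) simp
  also have "(\<integral>\<^sup>+i. emeasure lborel (ball (fst i) (snd i)) \<partial>count_space C) = emeasure lborel (\<Union>i\<in>C. ball (fst i) (snd i))"
    using C by (intro emeasure_UN_countable[symmetric]) (auto simp: disjoint_family_on_def pairwise_def disjnt_def)
  also have "\<dots> \<le> emeasure lborel U"
  proof (rule emeasure_mono)
    show "(\<Union>i\<in>C. ball (fst i) (snd i)) \<subseteq> U" using Kb(3) by blast
  qed (use U in simp)
  also have "emeasure lborel U \<le> emeasure lborel S + emeasure lborel (U - S)"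
    using U S by (subst plus_emeasure) (auto intro!: emeasure_mono)
  also have "\<dots> \<le> emeasure lborel S + ennreal (e / c)"
    using U by (intro add_left_mono) auto
  also have "ennreal c * (emeasure lborel S + ennreal (e / c)) = ennreal c * emeasure lborel S + ennreal e"
    using c \<open>e > 0\<close> by (simp add: distrib_left ennreal_mult[symmetric])
  finally show "emeasure lborel T \<le> ennreal ((2 * L) ^ DIM('a)) * emeasure lborel S + ennreal e"
    using T by (simp add: c_def mult_left_mono)
qed

subsection \<open>Balls minimize the fractional perimeter\<close>

text \<open>The map \<open>a \<mapsto> (1 / (a \<bullet> a)) *\<^sub>R a\<close> is inversion in the
  unit sphere. It is the only nonlinear ingredient in the dependence of \<open>reflect a x\<close>
  on \<open>a\<close>.\<close>

lemma norm_inversion_diff: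
  fixes a b :: "'a::real_inner"
  assumes "a \<noteq> 0" "b \<noteq> 0"
  shows "norm ((1 / (a \<bullet> a)) *\<^sub>R a - (1 / (b \<bullet> b)) *\<^sub>R b) = norm (a - b) / (norm a * norm b)"
proof -
  have "norm ((1 / (a \<bullet> a)) *\<^sub>R a - (1 / (b \<bullet> b)) *\<^sub>R b) ^ 2 = (norm (a - b) / (norm a * norm b)) ^ 2"
    using assms unfolding power_divide power_mult_distrib power2_norm_eq_inner
    by (simp add: inner_diff_left inner_diff_right inner_commute field_simps)
  then show ?thesis by (simp add: power2_eq_iff_nonneg)
qed

text \<open>With \<open>?J\<close> the inversion,
  \<open>reflect a x = x + a - 2 (x \<bullet> a) ?J a\<close>. The product is split as in the
  product rule, with \<open>?J\<close> bounded by \<open>1 / r\<close> and having Lipschitz constant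
  \<open>1 / r ^ 2\<close> away from the ball of radius \<open>r\<close>.\<close>

lemma reflect_lipschitz:
  fixes a b x :: "'a::real_inner"
  assumes "0 < r" "r \<le> norm a" "r \<le> norm b" "norm b \<le> M" "norm x \<le> \<rho>"
  shows "norm (reflect a x - reflect b x) \<le> (1 + 2 * (\<rho> / r + \<rho> * M / r ^ 2)) * norm (a - b)"
proof -
  let ?J = "\<lambda>a. (1 / (a \<bullet> a)) *\<^sub>R a"
  have ab: "a \<noteq> 0" "b \<noteq> 0" using assms by auto
  have \<rho>: "0 \<le> \<rho>" and M: "0 \<le> M" using assms norm_ge_zero order_trans by blast+
  have "norm (?J a) = 1 / norm a"
    using ab by (simp add: power2_norm_eq_inner[symmetric] power2_eq_square)
  also have "\<dots> \<le> 1 / r" using assms ab by (intro divide_left_mono mult_pos_pos) auto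
  finally have J: "norm (?J a) \<le> 1 / r" .
  have "norm (a - b) / (norm a * norm b) \<le> norm (a - b) / (r * r)"
    using assms ab by (intro divide_left_mono mult_mono) auto
  then have JJ: "norm (?J a - ?J b) \<le> norm (a - b) / r ^ 2"
    by (simp add: norm_inversion_diff[OF ab] power2_eq_square)
  have 1: "norm ((x \<bullet> (a - b)) *\<^sub>R ?J a) \<le> (\<rho> * norm (a - b)) * (1 / r)"
    unfolding norm_scaleR using J assms \<rho>
    by (intro mult_mono order_trans[OF Cauchy_Schwarz_ineq2] mult_right_mono) auto
  have 2: "norm ((x \<bullet> b) *\<^sub>R (?J a - ?J b)) \<le> (\<rho> * M) * (norm (a - b) / r ^ 2)"
    unfolding norm_scaleR using JJ assms \<rho> M
    by (intro mult_mono order_trans[OF Cauchy_Schwarz_ineq2] mult_nonneg_nonneg) auto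
  have "reflect a x - reflect b x = (a - b) - 2 *\<^sub>R ((x \<bullet> (a - b)) *\<^sub>R ?J a + (x \<bullet> b) *\<^sub>R (?J a - ?J b))"
    by (simp add: reflect_def inner_diff_right scaleR_diff_left scaleR_diff_right scaleR_add_right diff_divide_distrib)
  also have "norm \<dots> \<le> norm (a - b) + 2 * (norm ((x \<bullet> (a - b)) *\<^sub>R ?J a) + norm ((x \<bullet> b) *\<^sub>R (?J a - ?J b)))"
  proof -
    have "norm (u - 2 *\<^sub>R (v + w)) \<le> norm u + 2 * (norm v + norm w)" for u v w :: 'a
      using norm_triangle_ineq4[of u "2 *\<^sub>R (v + w)"] norm_triangle_ineq[of v w] by simp
    then show ?thesis .
  qed
  also have "\<dots> \<le> norm (a - b) + 2 * ((\<rho> * norm (a - b)) * (1 / r) + (\<rho> * M) * (norm (a - b) / r ^ 2))"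
    using 1 2 by (intro add_left_mono mult_left_mono add_mono) auto
  also have "\<dots> = (1 + 2 * (\<rho> / r + \<rho> * M / r ^ 2)) * norm (a - b)"
    by (simp add: algebra_simps)
  finally show ?thesis .
qed

text \<open>The mirror is the perpendicular bisector of \<open>x\<close> and \<open>y\<close>, and
  \<open>a\<close> is the reflection of \<open>0\<close> in it. Its length is
  \<open>(norm y - norm x) * (norm y + norm x) / norm (y - x)\<close>, and the triangle inequality
  bounds it on both sides.\<close>

lemma reflect_exists:
  fixes x y :: "'a::real_inner"
  assumes "norm x < norm y"
  obtains a where "reflect a x = y" "norm y - norm x \<le> norm a" "norm a \<le> norm y + norm x"
proof
  define d where "d = y - x"
  \<comment> \<open>The mirror passes through \<open>a / 2\<close>; this factor makes it pass
    through the midpoint of \<open>x\<close> and \<open>y\<close> as well.\<close>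
  define t where "t = (norm y ^ 2 - norm x ^ 2) / norm d ^ 2"
  have d: "d \<noteq> 0" "norm d > 0" using assms by (auto simp: d_def)
  have pos: "0 < norm y ^ 2 - norm x ^ 2" using assms by (simp add: power_strict_mono)
  then have t: "t > 0" using d by (simp add: t_def)
  have "t - 2 * (x \<bullet> d) / (d \<bullet> d) = 1"
  proof -
    have "norm y ^ 2 - norm x ^ 2 - 2 * (x \<bullet> d) = d \<bullet> d"
      by (simp add: d_def power2_norm_eq_inner inner_diff_left inner_diff_right inner_commute)
    then show ?thesis
      using d by (simp add: t_def power2_norm_eq_inner diff_divide_distrib[symmetric])
  qed
  moreover have "reflect (t *\<^sub>R d) x = x + (t - 2 * (x \<bullet> d) / (d \<bullet> d)) *\<^sub>R d"
    using t d by (simp add: reflect_def scaleR_diff_left)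
  ultimately show "reflect (t *\<^sub>R d) x = y" by (simp add: d_def)
  have n: "norm (t *\<^sub>R d) = (norm y - norm x) * (norm y + norm x) / norm d"
    using t d by (simp add: t_def power2_eq_square field_simps)
  have "norm d \<le> norm y + norm x" "norm y - norm x \<le> norm d"
    by (simp_all add: d_def norm_triangle_ineq4 norm_triangle_ineq2)
  then show "norm y - norm x \<le> norm (t *\<^sub>R d)" "norm (t *\<^sub>R d) \<le> norm y + norm x"
    unfolding n using d assms by (simp_all add: pos_le_divide_eq pos_divide_le_eq mult_left_mono)
qed

text \<open>
  Averaging over all mirrors: every pair \<open>x \<in> B - E\<close>, \<open>y \<in> E - B\<close> is swapped by exactly one
  mirror, and \<open>a \<mapsto> reflect a x\<close> is Lipschitz once \<open>a\<close> is bounded away from \<open>0\<close>.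
\<close>
lemma ex_reflect_gain:
  assumes \<delta>: "0 < \<delta>" and \<rho>: "0 < \<rho>"
  obtains g :: real where "0 < g"
    "\<And>E :: 'a::euclidean_space set. E \<in> sets borel \<Longrightarrow> E \<subseteq> cball 0 R \<Longrightarrow>
       ennreal \<delta> \<le> emeasure lborel (ball 0 \<rho> - E) \<Longrightarrow> ennreal \<delta> \<le> emeasure lborel (E - ball 0 \<rho>) \<Longrightarrow>
       \<exists>a. a \<noteq> 0 \<and> ennreal g \<le> emeasure lborel {x \<in> ball 0 \<rho> - E. reflect a x \<in> E - ball 0 \<rho>}"
proof -
  let ?\<omega> = "unit_ball_vol (real DIM('a))"
  have "((\<lambda>r. ?\<omega> * \<rho> ^ DIM('a) - ?\<omega> * (\<rho> - r) ^ DIM('a)) \<longlongrightarrow> ?\<omega> * \<rho> ^ DIM('a) - ?\<omega> * (\<rho> - 0) ^ DIM('a)) (at_right 0)"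
    by (intro tendsto_intros)
  then have "\<forall>\<^sub>F r in at_right 0. ?\<omega> * \<rho> ^ DIM('a) - ?\<omega> * (\<rho> - r) ^ DIM('a) < \<delta> / 2"
    using \<delta> by (intro order_tendstoD(2)) auto
  moreover have "\<forall>\<^sub>F r in at_right 0. r \<in> {0<..<\<rho>}"
    using \<rho> by (rule eventually_at_right_real)
  ultimately have "\<forall>\<^sub>F r in at_right 0. r \<in> {0<..<\<rho>} \<and> ?\<omega> * \<rho> ^ DIM('a) - ?\<omega> * (\<rho> - r) ^ DIM('a) < \<delta> / 2"
    by eventually_elim auto
  \<comment> \<open>Dropping a shell of width \<open>r\<close> costs less than
    \<open>\<delta> / 2\<close> of volume. In exchange, a mirror that takes a point of the smaller
    ball outside \<open>ball 0 \<rho>\<close> has \<open>norm a\<close> at least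
    \<open>r\<close>.\<close>
  then obtain r where r: "0 < r" "r < \<rho>" "?\<omega> * \<rho> ^ DIM('a) - ?\<omega> * (\<rho> - r) ^ DIM('a) < \<delta> / 2"
    using eventually_happens' trivial_limit_at_right_real by (metis (mono_tags, lifting) greaterThanLessThan_iff)
  \<comment> \<open>A mirror that swaps \<open>x\<close> in the ball with \<open>y\<close> in
    \<open>cball 0 R\<close> has \<open>norm a \<le> norm y + norm x\<close>; the \<open>max\<close>
    covers negative \<open>R\<close>.\<close>
  define M where "M = max 0 (R + \<rho>)"
  define L where "L = 1 + 2 * (\<rho> / r + \<rho> * M / r ^ 2)"
  have M: "0 \<le> M" by (simp add: M_def)
  have L: "0 < L" unfolding L_def using r \<rho> M by (intro add_pos_nonneg) auto
  define c where "c = (2 * L) ^ DIM('a)"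
  have c: "0 < c" using L by (simp add: c_def)
  define A :: "'a set" where "A = {a. r \<le> norm a \<and> norm a \<le> M}"
  have [measurable]: "A \<in> sets borel" unfolding A_def by measurable
  define V where "V = ?\<omega> * M ^ DIM('a)"
  have V: "0 \<le> V" using M by (simp add: V_def)
  have eA: "emeasure lborel A \<le> ennreal V"
  proof -
    have "emeasure lborel A \<le> emeasure lborel (cball (0::'a) M)"
      by (intro emeasure_mono) (auto simp: A_def)
    then show ?thesis using M by (simp add: emeasure_cball V_def)
  qed
  \<comment> \<open>Each of the points of \<open>F\<close>, of volume at least
    \<open>\<delta> / 2\<close>, has mirrors of volume at least \<open>\<delta> / c\<close>. The
    total is shared among parameters of volume at most \<open>V\<close>; dividing by
    \<open>V + 1\<close> is safe for \<open>V = 0\<close> and makes the contradiction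
    strict.\<close>
  define g where "g = \<delta> / 2 * (\<delta> / c) / (V + 1)"
  have g: "0 < g" using \<delta> c V by (simp add: g_def)
  show thesis
  proof
    show "0 < g" by fact
    fix E :: "'a set"
    assume E[measurable]: "E \<in> sets borel" and ER: "E \<subseteq> cball 0 R"
      and \<delta>1: "ennreal \<delta> \<le> emeasure lborel (ball 0 \<rho> - E)" and \<delta>2: "ennreal \<delta> \<le> emeasure lborel (E - ball 0 \<rho>)"
    define F where "F = ball 0 (\<rho> - r) - E"
    define G where "G = E - ball 0 \<rho>"
    have [measurable]: "F \<in> sets borel" "G \<in> sets borel" by (simp_all add: F_def G_def)
    have F: "ennreal (\<delta> / 2) \<le> emeasure lborel F"
    proof -
      have "ennreal \<delta> \<le> emeasure lborel (F \<union> (ball 0 \<rho> - ball 0 (\<rho> - r)))"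
        using \<delta>1 by (rule order_trans) (auto simp: F_def intro!: emeasure_mono)
      also have "\<dots> \<le> emeasure lborel F + emeasure lborel (ball 0 \<rho> - ball (0::'a) (\<rho> - r))"
        by (rule emeasure_subadditive) auto
      also have "emeasure lborel (ball 0 \<rho> - ball (0::'a) (\<rho> - r)) = ennreal (?\<omega> * \<rho> ^ DIM('a) - ?\<omega> * (\<rho> - r) ^ DIM('a))"
        using r by (subst emeasure_Diff) (auto simp: emeasure_ball ennreal_minus)
      finally have "ennreal \<delta> \<le> emeasure lborel F + ennreal (?\<omega> * \<rho> ^ DIM('a) - ?\<omega> * (\<rho> - r) ^ DIM('a))" .
      also have "\<dots> \<le> emeasure lborel F + ennreal (\<delta> / 2)"
        using r by (intro add_left_mono ennreal_leI) simp
      finally have "ennreal \<delta> \<le> ennreal (\<delta> / 2) + emeasure lborel F"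
        by (metis add.commute)
      moreover have "ennreal (\<delta> / 2) + ennreal (\<delta> / 2) = ennreal \<delta>"
        using \<delta> ennreal_plus[of "\<delta> / 2" "\<delta> / 2"] by simp
      ultimately have "ennreal (\<delta> / 2) + ennreal (\<delta> / 2) \<le> ennreal (\<delta> / 2) + emeasure lborel F"
        by simp
      then show ?thesis by (simp only: ennreal_add_left_cancel_le) simp
    qed
    have [measurable]: "(\<lambda>p. reflect (fst p) (snd p)) \<in> borel_measurable (borel \<Otimes>\<^sub>M borel :: ('a \<times> 'a) measure)"
      unfolding reflect_def by measurable
    have refl2 [measurable]: "(\<lambda>a. reflect a x) \<in> borel_measurable borel" for x :: 'a
      unfolding reflect_def by measurable
    \<comment> \<open>As \<open>a\<close> runs over the mirrors that send \<open>x\<close> into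
      \<open>G\<close>, the points \<open>reflect a x\<close> cover \<open>G\<close>. A Lipschitz
      map cannot cover a set of volume \<open>\<delta>\<close> starting from a much smaller
      one.\<close>
    have mirror: "ennreal (\<delta> / c) \<le> emeasure lborel {a \<in> A. reflect a x \<in> G}" if "x \<in> F" for x
    proof -
      have x: "norm x < \<rho> - r" using that by (simp add: F_def)
      have "G \<subseteq> (\<lambda>a. reflect a x) ` {a \<in> A. reflect a x \<in> G}"
      proof
        fix y assume y: "y \<in> G"
        then have ny: "\<rho> \<le> norm y" "norm y \<le> R" using ER by (auto simp: G_def)
        then have "norm x < norm y" using x r by linarith
        then obtain a where a: "reflect a x = y" "norm y - norm x \<le> norm a" "norm a \<le> norm y + norm x"
          by (rule reflect_exists)
        then have "a \<in> A" using ny x r by (auto simp: A_def M_def)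
        then show "y \<in> (\<lambda>a. reflect a x) ` {a \<in> A. reflect a x \<in> G}" using a y by auto
      qed
      moreover have "norm (reflect a x - reflect b x) \<le> L * norm (a - b)"
        if "a \<in> {a \<in> A. reflect a x \<in> G}" "b \<in> {a \<in> A. reflect a x \<in> G}" for a b
        unfolding L_def using that r x by (intro reflect_lipschitz) (auto simp: A_def)
      moreover have "(\<lambda>a. reflect a x) -` G \<in> sets borel"
        using measurable_sets[OF refl2, of G x] by simp
      then have "A \<inter> (\<lambda>a. reflect a x) -` G \<in> sets borel" by simp
      moreover have "A \<inter> (\<lambda>a. reflect a x) -` G = {a \<in> A. reflect a x \<in> G}" by auto
      ultimately have "emeasure lborel G \<le> ennreal c * emeasure lborel {a \<in> A. reflect a x \<in> G}"
        unfolding c_def using L by (intro emeasure_lipschitz_image_le[where f="\<lambda>a. reflect a x"]) auto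
      with \<delta>2 have "ennreal \<delta> \<le> ennreal c * emeasure lborel {a \<in> A. reflect a x \<in> G}"
        by (simp add: G_def)
      then have "ennreal (1 / c) * ennreal \<delta> \<le> ennreal (1 / c) * (ennreal c * emeasure lborel {a \<in> A. reflect a x \<in> G})"
        by (intro mult_left_mono) auto
      then show ?thesis using c \<delta>
        by (simp add: mult.assoc[symmetric] flip: ennreal_mult)
    qed
    show "\<exists>a. a \<noteq> 0 \<and> ennreal g \<le> emeasure lborel {x \<in> ball 0 \<rho> - E. reflect a x \<in> E - ball 0 \<rho>}"
    proof (rule ccontr)
      assume "\<not> ?thesis"
      then have small: "emeasure lborel {x \<in> ball 0 \<rho> - E. reflect a x \<in> E - ball 0 \<rho>} \<le> ennreal g" if "a \<noteq> 0" for a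
        using that by (meson linear)
      \<comment> \<open>Double counting of the triples of a mirror and a swapped pair, as an
        integral over \<open>x\<close> and \<open>a\<close>: integrating over \<open>a\<close> first
        bounds it below, integrating over \<open>x\<close> first bounds it above by
        \<open>g * V\<close>.\<close>
      have "ennreal (\<delta> / 2 * (\<delta> / c)) \<le> ennreal (\<delta> / c) * emeasure lborel F"
      proof -
        have "ennreal (\<delta> / 2 * (\<delta> / c)) = ennreal (\<delta> / c) * ennreal (\<delta> / 2)"
          using \<delta> c by (subst mult.commute, subst ennreal_mult) auto
        then show ?thesis using F by (simp add: mult_left_mono)
      qed
      also have "\<dots> = (\<integral>\<^sup>+x. ennreal (\<delta> / c) * indicator F x \<partial>lborel)"
        by (simp add: nn_integral_cmult)
      also have "\<dots> \<le> (\<integral>\<^sup>+x. (\<integral>\<^sup>+a. indicator F x * (indicator A a * indicator G (reflect a x)) \<partial>lborel) \<partial>lborel)"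
      proof (rule nn_integral_mono)
        fix x
        show "ennreal (\<delta> / c) * indicator F x \<le> (\<integral>\<^sup>+a. indicator F x * (indicator A a * indicator G (reflect a x)) \<partial>lborel)"
        proof (cases "x \<in> F")
          case True
          have "(\<integral>\<^sup>+a. indicator A a * indicator G (reflect a x) \<partial>lborel)
            = (\<integral>\<^sup>+a. indicator {a \<in> A. reflect a x \<in> G} a \<partial>lborel)"
            by (intro nn_integral_cong) (auto simp: indicator_def)
          also have "\<dots> = emeasure lborel {a \<in> A. reflect a x \<in> G}"
            by (rule nn_integral_indicator) measurable
          finally show ?thesis using mirror[OF True] True by simp
        qed simp
      qed
      also have "\<dots> = (\<integral>\<^sup>+a. (\<integral>\<^sup>+x. indicator F x * (indicator A a * indicator G (reflect a x)) \<partial>lborel) \<partial>lborel)"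
        by (rule lborel_pair.Fubini') measurable
      also have "\<dots> \<le> (\<integral>\<^sup>+a. ennreal g * indicator A a \<partial>lborel)"
      proof (rule nn_integral_mono)
        fix a
        show "(\<integral>\<^sup>+x. indicator F x * (indicator A a * indicator G (reflect a x)) \<partial>lborel) \<le> ennreal g * indicator A a"
        proof (cases "a \<in> A")
          case True
          then have "a \<noteq> 0" using r by (auto simp: A_def)
          let ?W = "{x \<in> ball 0 \<rho> - E. reflect a x \<in> E - ball 0 \<rho>}"
          have "?W = (ball 0 \<rho> - E) \<inter> reflect a -` G" by (auto simp: G_def)
          moreover have "reflect a -` G \<in> sets borel"
            using measurable_sets[OF measurable_reflect, of G a] by simp
          ultimately have W: "?W \<in> sets borel" by simp
          have "(\<integral>\<^sup>+x. indicator F x * (indicator A a * indicator G (reflect a x)) \<partial>lborel)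
            \<le> (\<integral>\<^sup>+x. indicator ?W x \<partial>lborel)"
            using r by (intro nn_integral_mono) (auto simp: indicator_def F_def G_def)
          also have "\<dots> \<le> ennreal g" using small[OF \<open>a \<noteq> 0\<close>] W by simp
          finally show ?thesis using True by simp
        qed simp
      qed
      also have "\<dots> = ennreal g * emeasure lborel A"
        by (simp add: nn_integral_cmult)
      also have "\<dots> \<le> ennreal g * ennreal V" by (intro mult_left_mono eA) simp
      finally have "\<delta> / 2 * (\<delta> / c) \<le> g * V"
        using g V by (simp flip: ennreal_mult)
      moreover have "g * (V + 1) = \<delta> / 2 * (\<delta> / c)" using V by (simp add: g_def)
      ultimately show False using g by (simp add: distrib_left)
    qed
  qed
qed

text \<open>Polarization preserves the volume and the inclusion in \<open>cball 0 R\<close>, so the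
  same \<open>g\<close> is available at every step. If no iterate were close, the overlap with the
  ball would grow by \<open>g\<close> each time and exceed the volume of the ball.\<close>

lemma ex_polarization_close:
  fixes E :: "'a::euclidean_space set"
  assumes E: "E \<in> sets borel" "E \<subseteq> cball 0 R" and vol: "emeasure lborel E = emeasure lborel (ball (0::'a) \<rho>)"
    and \<rho>: "0 < \<rho>" and s: "0 \<le> s" and \<delta>: "0 < \<delta>"
  obtains F :: "'a set" where "F \<in> sets borel" "per s F \<le> per s E"
    "emeasure lborel (ball 0 \<rho> - F) < ennreal \<delta>" "emeasure lborel (F - ball 0 \<rho>) < ennreal \<delta>"
proof (rule ccontr)
  assume no: "\<not> thesis"
  let ?B = "ball (0::'a) \<rho>"
  obtain g where g: "0 < g"
    "\<And>E :: 'a set. E \<in> sets borel \<Longrightarrow> E \<subseteq> cball 0 R \<Longrightarrow>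
       ennreal \<delta> \<le> emeasure lborel (?B - E) \<Longrightarrow> ennreal \<delta> \<le> emeasure lborel (E - ?B) \<Longrightarrow>
       \<exists>a. a \<noteq> 0 \<and> ennreal g \<le> emeasure lborel {x \<in> ?B - E. reflect a x \<in> E - ?B}"
    by (rule ex_reflect_gain[OF \<delta> \<rho>, where R=R]) (rule that)
  have "\<exists>F. F \<in> sets borel \<and> F \<subseteq> cball 0 R \<and> emeasure lborel F = emeasure lborel ?B \<and> per s F \<le> per s E
    \<and> ennreal (real k * g) \<le> emeasure lborel (F \<inter> ?B)" for k
  proof (induction k)
    case 0
    then show ?case using E vol by (intro exI[of _ E]) auto
  next
    case (Suc k)
    then obtain F where F[measurable]: "F \<in> sets borel" and F': "F \<subseteq> cball 0 R" "emeasure lborel F = emeasure lborel ?B" "per s F \<le> per s E"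
      "ennreal (real k * g) \<le> emeasure lborel (F \<inter> ?B)" by auto
    have fin: "emeasure lborel (F \<inter> ?B) \<noteq> \<infinity>"
    proof -
      have "emeasure lborel (F \<inter> ?B) \<le> emeasure lborel ?B" by (rule emeasure_mono) auto
      then show ?thesis using emeasure_lborel_ball_finite[of "0::'a" \<rho>] by (auto simp: less_top[symmetric] top_unique)
    qed
    have 1: "emeasure lborel ?B = emeasure lborel (F \<inter> ?B) + emeasure lborel (?B - F)"
      by (subst plus_emeasure) (auto intro!: arg_cong[where f="emeasure lborel"])
    have 2: "emeasure lborel F = emeasure lborel (F \<inter> ?B) + emeasure lborel (F - ?B)"
      by (subst plus_emeasure) (auto intro!: arg_cong[where f="emeasure lborel"])
    \<comment> \<open>Equal volumes make the two halves of the symmetric difference equally large,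
      so failure of one bound is failure of both.\<close>
    have "emeasure lborel (?B - F) = emeasure lborel (F - ?B)"
      using 1 2 F'(2) fin by (simp add: ennreal_add_left_cancel)
    then have "ennreal \<delta> \<le> emeasure lborel (?B - F)" "ennreal \<delta> \<le> emeasure lborel (F - ?B)"
      using no that[of F] F F' by (auto simp: not_less[symmetric])
    then obtain a where a: "a \<noteq> 0" "ennreal g \<le> emeasure lborel {x \<in> ?B - F. reflect a x \<in> F - ?B}"
      using g(2)[OF F F'(1)] by auto
    have "ennreal (real (Suc k) * g) = ennreal (real k * g) + ennreal g"
      using g(1) by (simp add: distrib_right flip: ennreal_plus)
    also have "\<dots> \<le> emeasure lborel (polarize a F \<inter> ?B)"
      using polarize_gain[OF F a(1), of \<rho>] F'(4) a(2) by (meson add_mono order_trans)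
    finally have "ennreal (real (Suc k) * g) \<le> emeasure lborel (polarize a F \<inter> ?B)" .
    then show ?case
      using F F' polarize_borel[OF F, of a] emeasure_polarize[OF F a(1)] per_polarize[OF F a(1) s]
        polarize_subset_cball[OF a(1) F'(1)]
      by (intro exI[of _ "polarize a F"]) auto
  qed
  note * = this
  have bound: "ennreal (real k * g) \<le> emeasure lborel ?B" for k
  proof -
    obtain F where "ennreal (real k * g) \<le> emeasure lborel (F \<inter> ?B)" using * by blast
    also have "\<dots> \<le> emeasure lborel ?B" by (rule emeasure_mono) auto
    finally show ?thesis .
  qed
  have "emeasure lborel ?B = ennreal (measure lborel ?B)" "0 \<le> measure lborel ?B"
    using emeasure_lborel_ball_finite[of "0::'a" \<rho>] by (auto simp: emeasure_eq_ennreal_measure)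
  then have "real k * g \<le> measure lborel ?B" for k using bound[of k] by simp
  moreover obtain k where "measure lborel ?B < real k * g"
    using reals_Archimedean3[OF g(1)] by auto
  ultimately show False by (simp add: not_less[symmetric])
qed

text \<open>Replacing \<open>B\<close> by \<open>F\<close> alters the exit volume by at most the two
  measures \<open>B - F\<close> and \<open>F - B\<close>, uniformly in \<open>h\<close>. Subtracting
  this error and applying monotone convergence gives lower semicontinuity without passing to
  subsequences.\<close>

lemma per_le_of_approx:
  fixes B :: "'a::euclidean_space set"
  assumes B[measurable]: "B \<in> sets borel" and fin: "emeasure lborel B \<noteq> top"
    and approx: "\<And>\<delta>. 0 < \<delta> \<Longrightarrow> \<exists>F. F \<in> sets borel \<and> per s F \<le> P \<and>
      emeasure lborel (B - F) < ennreal \<delta> \<and> emeasure lborel (F - B) < ennreal \<delta>"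
  shows "per s B \<le> P"
proof -
  \<comment> \<open>Subtraction in \<open>ennreal\<close> is truncated at \<open>0\<close>, so
    \<open>u k\<close> is a nonnegative sequence increasing to the exit volume; the 2 accounts for
    the two errors of size \<open>1 / Suc k\<close>.\<close>
  define u where "u k h = exit_volume B h - ennreal (2 / real (Suc k))" for k h
  have [measurable]: "u k \<in> borel_measurable borel" for k unfolding u_def[abs_def] by measurable
  have step: "(\<integral>\<^sup>+h. u k h * kern s h \<partial>lborel) \<le> P" for k
  proof -
    define d where "d = 1 / real (Suc k)"
    obtain F where F[measurable]: "F \<in> sets borel" and F': "per s F \<le> P"
      "emeasure lborel (B - F) < ennreal d" "emeasure lborel (F - B) < ennreal d"
      using approx[of d] by (auto simp: d_def)
    have "exit_volume B h \<le> ennreal (2 / real (Suc k)) + exit_volume F h" for h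
    proof -
      have [measurable]: "{x \<in> F. x + h \<notin> F} \<in> sets borel" "{x. x + h \<in> F - B} \<in> sets borel" by measurable
      have "exit_volume B h \<le> emeasure lborel ((B - F) \<union> {x. x + h \<in> F - B} \<union> {x \<in> F. x + h \<notin> F})"
        unfolding exit_volume_def by (rule emeasure_mono) auto
      also have "\<dots> \<le> emeasure lborel ((B - F) \<union> {x. x + h \<in> F - B}) + exit_volume F h"
        unfolding exit_volume_def by (rule emeasure_subadditive) auto
      also have "emeasure lborel ((B - F) \<union> {x. x + h \<in> F - B}) \<le> emeasure lborel (B - F) + emeasure lborel {x. x + h \<in> F - B}"
        by (rule emeasure_subadditive) auto
      also have "emeasure lborel {x. x + h \<in> F - B} = emeasure lborel (F - B)"
      proof -
        have "emeasure lborel {x. x + h \<in> F - B} = (\<integral>\<^sup>+x. indicator {x. x + h \<in> F - B} x \<partial>lborel)"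
          by (rule nn_integral_indicator[symmetric]) simp
        also have "\<dots> = (\<integral>\<^sup>+x. indicator (F - B) (x + h) \<partial>lborel)"
          by (intro nn_integral_cong) (auto simp: indicator_def)
        also have "\<dots> = emeasure lborel (F - B)"
          by (subst nn_integral_lborel_translate) auto
        finally show ?thesis .
      qed
      also have "emeasure lborel (B - F) + emeasure lborel (F - B) \<le> ennreal d + ennreal d"
        using F' by (intro add_mono) auto
      also have "ennreal d + ennreal d = ennreal (2 / real (Suc k))"
        by (subst ennreal_plus[symmetric]) (auto simp: d_def)
      finally show ?thesis by (simp add: add_right_mono)
    qed
    then have "u k h \<le> exit_volume F h" for h
      unfolding u_def by (simp add: ennreal_minus_le_iff)
    then have "(\<integral>\<^sup>+h. u k h * kern s h \<partial>lborel) \<le> per s F"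
      unfolding per_eq_exit_volume[OF F] by (intro nn_integral_mono mult_right_mono) auto
    then show ?thesis using F' by simp
  qed
  have inc: "incseq u"
    unfolding u_def[abs_def] by (intro monoI le_funI ennreal_mono_minus ennreal_leI) (auto intro!: divide_left_mono)
  have sup: "(SUP k. u k h) = exit_volume B h" for h
  proof -
    have "exit_volume B h \<le> emeasure lborel B"
      unfolding exit_volume_def by (intro emeasure_mono) auto
    then have ntop: "exit_volume B h \<noteq> top" using fin by (auto simp: top_unique)
    have "(\<lambda>k. u k h) \<longlonglongrightarrow> exit_volume B h - 0"
      unfolding u_def
    proof (rule tendsto_diff_ennreal)
      have "(\<lambda>k. 2 / real (Suc k)) \<longlonglongrightarrow> 0"
        using tendsto_mult_left[OF LIMSEQ_inverse_real_of_nat, of 2] by (simp add: field_simps)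
      then show "(\<lambda>k. ennreal (2 / real (Suc k))) \<longlonglongrightarrow> 0"
        using tendsto_ennrealI[of "\<lambda>k. 2 / real (Suc k)" 0] by simp
    qed (simp_all add: ntop)
    moreover have "(\<lambda>k. u k h) \<longlonglongrightarrow> (SUP k. u k h)"
      using inc by (intro LIMSEQ_SUP) (auto simp: mono_def le_fun_def)
    ultimately show ?thesis using LIMSEQ_unique by fastforce
  qed
  have "per s B = (\<integral>\<^sup>+h. (SUP k. u k h * kern s h) \<partial>lborel)"
    unfolding per_eq_exit_volume[OF B] by (simp add: sup flip: SUP_mult_right_ennreal)
  also have "\<dots> = (SUP k. \<integral>\<^sup>+h. u k h * kern s h \<partial>lborel)"
    using inc by (intro nn_integral_monotone_convergence_SUP) (auto simp: mono_def le_fun_def intro!: mult_right_mono)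
  also have "\<dots> \<le> P" by (intro SUP_least step)
  finally show ?thesis .
qed

theorem per_ball_le:
  fixes E :: "'a::euclidean_space set"
  assumes E: "E \<in> sets borel" "bounded E" and vol: "emeasure lborel E = emeasure lborel (ball (0::'a) \<rho>)"
    and \<rho>: "0 < \<rho>" and s: "0 \<le> s"
  shows "per s (ball (0::'a) \<rho>) \<le> per s E"
proof (rule per_le_of_approx)
  obtain R where R: "E \<subseteq> cball 0 R" using E(2) bounded_subset_ballD[of E 0] ball_subset_cball by blast
  show "\<exists>F :: 'a set. F \<in> sets borel \<and> per s F \<le> per s E \<and>
      emeasure lborel (ball 0 \<rho> - F) < ennreal \<delta> \<and> emeasure lborel (F - ball 0 \<rho>) < ennreal \<delta>"
    if "0 < \<delta>" for \<delta>
    by (rule ex_polarization_close[OF E(1) R vol \<rho> s that]) auto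
qed (use emeasure_lborel_ball_finite in \<open>auto simp: less_top[symmetric]\<close>)

subsection \<open>The sharp isoperimetric inequality\<close>

lemma kern_scale:
  assumes "0 < c" shows "kern s (c *\<^sub>R z) = ennreal (c powr (- s)) * kern s z"
proof -
  have "ennreal (norm (c *\<^sub>R z) powr s) = ennreal (c powr s) * ennreal (norm z powr s)"
    using assms by (simp add: powr_mult ennreal_mult)
  then show ?thesis
    using assms unfolding kern_def
    by (simp add: ennreal_inverse_mult inverse_ennreal powr_minus)
qed

lemma measurable_per_integrand:
  assumes [measurable]: "E \<in> sets borel"
  shows "(\<lambda>x. \<integral>\<^sup>+y. indicator E x * indicator (- E) y * kern s (x - y) \<partial>lborel) \<in> borel_measurable borel"
    "(\<lambda>y. indicator E x * indicator (- E) y * kern s (x - y)) \<in> borel_measurable borel"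
  by measurable

lemma ennreal_le_suminf: "f j \<le> (\<Sum>j. f j :: ennreal)"
  using sum_le_suminf[OF summableI, of "{j}" f] by simp

text \<open>The two integrals contribute \<open>c ^ DIM('a)\<close> each and the kernel
  \<open>c powr (- s)\<close>. For \<open>s = DIM('a) + \<alpha>\<close> the exponent is
  \<open>DIM('a) - \<alpha>\<close>, the one that makes the isoperimetric inequality scale
  invariant.\<close>

lemma per_ball_scale:
  fixes s c :: real
  assumes c: "0 < c"
  shows "per s (ball (0::'a::euclidean_space) c) = ennreal (c powr (2 * real DIM('a) - s)) * per s (ball (0::'a) 1)"
proof -
  let ?d = "DIM('a)"
  let ?F = "\<lambda>c x y. indicator (ball (0::'a) c) x * indicator (- ball 0 c) y * kern s (x - y)"
  have "per s (ball (0::'a) c) = ennreal (c ^ ?d) * (\<integral>\<^sup>+x. \<integral>\<^sup>+y. ?F c (c *\<^sub>R x) y \<partial>lborel \<partial>lborel)"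
    unfolding per_def using c
    by (subst nn_integral_lborel_scale[of _ c, OF measurable_per_integrand(1)]) auto
  also have "(\<integral>\<^sup>+x. \<integral>\<^sup>+y. ?F c (c *\<^sub>R x) y \<partial>lborel \<partial>lborel)
    = (\<integral>\<^sup>+x. ennreal (c ^ ?d * c powr (- s)) * (\<integral>\<^sup>+y. ?F 1 x y \<partial>lborel) \<partial>lborel)"
  proof (rule nn_integral_cong)
    fix x :: 'a
    have eq: "?F c (c *\<^sub>R x) (c *\<^sub>R y) = ennreal (c powr (- s)) * ?F 1 x y" for y
    proof -
      have "kern s (c *\<^sub>R x - c *\<^sub>R y) = ennreal (c powr (- s)) * kern s (x - y)"
        using kern_scale[OF c, of s "x - y"] by (simp add: scaleR_diff_right)
      then show ?thesis using c by (auto simp: indicator_def)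
    qed
    have "(\<integral>\<^sup>+y. ?F c (c *\<^sub>R x) y \<partial>lborel) = ennreal (c ^ ?d) * (\<integral>\<^sup>+y. ?F c (c *\<^sub>R x) (c *\<^sub>R y) \<partial>lborel)"
      using c by (subst nn_integral_lborel_scale[of _ c, OF measurable_per_integrand(2)]) auto
    also have "\<dots> = ennreal (c ^ ?d * c powr (- s)) * (\<integral>\<^sup>+y. ?F 1 x y \<partial>lborel)"
      unfolding eq using c by (subst nn_integral_cmult) (auto simp: ennreal_mult mult_ac)
    finally show "(\<integral>\<^sup>+y. ?F c (c *\<^sub>R x) y \<partial>lborel) = ennreal (c ^ ?d * c powr (- s)) * (\<integral>\<^sup>+y. ?F 1 x y \<partial>lborel)" .
  qed
  also have "\<dots> = ennreal (c ^ ?d * c powr (- s)) * per s (ball (0::'a) 1)"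
    unfolding per_def by (rule nn_integral_cmult) (simp add: measurable_per_integrand)
  finally have "per s (ball (0::'a) c) = ennreal (c ^ ?d * (c ^ ?d * c powr (- s))) * per s (ball (0::'a) 1)"
    using c by (simp add: ennreal_mult mult.assoc)
  also have "c ^ ?d * (c ^ ?d * c powr (- s)) = c powr (2 * real ?d - s)"
    using c by (simp add: powr_realpow[symmetric] powr_add[symmetric])
  finally show ?thesis .
qed

lemma per_ball_pos:
  assumes s: "0 \<le> s" shows "0 < per s (ball (0::'a::euclidean_space) 1)"
proof -
  let ?A = "ball (0::'a) 1" and ?C = "ball (0::'a) 2 - ball 0 1"
  \<comment> \<open>A point of the unit ball and a point of norm less than 2 are at distance at most
    3.\<close>
  have k: "ennreal (3 powr (- s)) \<le> kern s (x - y)" if "x \<in> ?A" "y \<in> ?C" for x y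
  proof (cases "x = y")
    case False
    have "norm (x - y) \<le> 3" using that norm_triangle_ineq4[of x y] by auto
    then have "inverse (3 powr s) \<le> inverse (norm (x - y) powr s)"
      using False s by (intro le_imp_inverse_le powr_mono2) auto
    then show ?thesis using False by (simp add: kern_def inverse_ennreal powr_minus ennreal_leI)
  qed (use that in auto)
  have eC: "emeasure lborel ?C = ennreal (unit_ball_vol (real DIM('a)) * (2 ^ DIM('a) - 1))"
    by (subst emeasure_Diff) (auto simp: emeasure_ball ennreal_minus algebra_simps)
  have "(1::real) < 2 ^ DIM('a)" by (rule one_less_power) auto
  then have "0 < (ennreal (3 powr (- s)) * emeasure lborel ?C) * emeasure lborel ?A"
    unfolding eC by (simp add: emeasure_ball ennreal_zero_less_mult_iff)
  also have "\<dots> = (\<integral>\<^sup>+x. (\<integral>\<^sup>+y. ennreal (3 powr (- s)) * indicator ?C y \<partial>lborel) * indicator ?A x \<partial>lborel)"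
    by (subst (1 2) nn_integral_cmult_indicator) auto
  also have "\<dots> \<le> per s ?A"
    unfolding per_def
  proof (rule nn_integral_mono)
    fix x
    have "(\<integral>\<^sup>+y. ennreal (3 powr (- s)) * indicator ?C y \<partial>lborel) \<le> (\<integral>\<^sup>+y. indicator (- ?A) y * kern s (x - y) \<partial>lborel)" if "x \<in> ?A"
      using k[OF that] by (intro nn_integral_mono) (auto simp: indicator_def)
    then show "(\<integral>\<^sup>+y. ennreal (3 powr (- s)) * indicator ?C y \<partial>lborel) * indicator ?A x
      \<le> (\<integral>\<^sup>+y. indicator ?A x * indicator (- ?A) y * kern s (x - y) \<partial>lborel)"
      by (cases "x \<in> ?A") auto
  qed
  finally show ?thesis .
qed

text \<open>On each dyadic shell the integrand is at most \<open>?c j\<close>, and the shell lies in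
  a ball of radius \<open>(1/2) ^ j\<close>. The resulting series is geometric with ratio
  \<open>(1/2) powr (real DIM('a) - \<beta>)\<close>.\<close>

lemma nn_integral_powr_near_finite:
  fixes \<beta> :: real
  assumes "0 < \<beta>" "\<beta> < real DIM('a::euclidean_space)"
  shows "(\<integral>\<^sup>+h. ennreal (norm h powr (- \<beta>)) * indicator (cball (0::'a) 1) h \<partial>lborel) < top"
proof -
  let ?d = "DIM('a)" and ?\<omega> = "unit_ball_vol (real DIM('a))"
  let ?c = "\<lambda>j::nat. ((1/2) ^ Suc j) powr (- \<beta>)"
  have "(\<integral>\<^sup>+h. ennreal (norm h powr (- \<beta>)) * indicator (cball (0::'a) 1) h \<partial>lborel)
    \<le> (\<integral>\<^sup>+h. (\<Sum>j. ennreal (?c j) * indicator (cball (0::'a) ((1/2) ^ j)) h) \<partial>lborel)"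
  proof (rule nn_integral_mono)
    fix h :: 'a
    show "ennreal (norm h powr (- \<beta>)) * indicator (cball 0 1) h \<le> (\<Sum>j. ennreal (?c j) * indicator (cball (0::'a) ((1/2) ^ j)) h)"
    proof (cases "h = 0 \<or> norm h > 1")
      case False
      then have h: "0 < norm h" "norm h \<le> 1" by auto
      define m where "m = (LEAST m. (1/2) ^ m < norm h)"
      obtain m' where "(1/2) ^ m' < norm h" using real_arch_pow_inv[OF h(1), of "1/2"] by auto
      then have m: "(1/2) ^ m < norm h" unfolding m_def by (rule LeastI)
      have "m \<noteq> 0" using m h by (cases m) auto
      then obtain j where j: "m = Suc j" by (cases m) auto
      then have "\<not> (1/2) ^ j < norm h" using not_less_Least[of j "\<lambda>m. (1/2) ^ m < norm h"] by (simp add: m_def)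
      then have hj: "h \<in> cball 0 ((1/2) ^ j)" by simp
      have "norm h powr (- \<beta>) \<le> ?c j"
        using m j assms by (intro powr_mono2') auto
      then have "ennreal (norm h powr (- \<beta>)) \<le> ennreal (?c j) * indicator (cball (0::'a) ((1/2) ^ j)) h"
        using hj by (simp add: ennreal_leI)
      also have "\<dots> \<le> (\<Sum>j. ennreal (?c j) * indicator (cball (0::'a) ((1/2) ^ j)) h)"
        by (rule ennreal_le_suminf)
      finally have "ennreal (norm h powr (- \<beta>)) \<le> (\<Sum>j. ennreal (?c j) * indicator (cball (0::'a) ((1/2) ^ j)) h)" .
      then show ?thesis using h by (simp only: indicator_def mem_cball_0 of_bool_def if_True mult_1_right)
    next
      \<comment> \<open>At \<open>h = 0\<close> the integrand vanishes because
        \<open>0 powr _ = 0\<close>.\<close>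
      case True
      then have "ennreal (norm h powr (- \<beta>)) * indicator (cball 0 1) h = 0" by auto
      then show ?thesis by (simp only: zero_le)
    qed
  qed
  also have "\<dots> = (\<Sum>j. \<integral>\<^sup>+h. ennreal (?c j) * indicator (cball (0::'a) ((1/2) ^ j)) h \<partial>lborel)"
    by (rule nn_integral_suminf) (simp add: borel_measurable_times_ennreal borel_measurable_indicator)
  also have "\<dots> = (\<Sum>j. ennreal (?c j * (?\<omega> * ((1/2) ^ j) ^ ?d)))"
    by (intro suminf_cong) (simp add: nn_integral_cmult_indicator emeasure_cball ennreal_mult'[symmetric])
  also have "\<dots> < top"
  proof -
    let ?q = "(1/2::real) powr (real ?d - \<beta>)"
    have geo: "?c j * (?\<omega> * ((1/2) ^ j) ^ ?d) = (?\<omega> * (1/2) powr (- \<beta>)) * ?q ^ j" for j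
    proof -
      have "?c j * ((1/2) ^ j) ^ ?d = (1/2) powr (- \<beta>) * ?q ^ j"
        unfolding powr_realpow[symmetric, of "1/2", simplified] powr_powr powr_power
        by (simp add: powr_add[symmetric] powr_realpow[symmetric] powr_powr algebra_simps)
      then show ?thesis by (simp add: mult_ac)
    qed
    have "?q < 1" using powr_less_mono[of 0 "real ?d - \<beta>" 2] assms by (simp add: powr_divide)
    then have "summable (\<lambda>j. (?\<omega> * (1/2) powr (- \<beta>)) * ?q ^ j)"
      by (intro summable_mult summable_geometric) auto
    then have "summable (\<lambda>j. ?c j * (?\<omega> * ((1/2) ^ j) ^ ?d))" unfolding geo .
    then show ?thesis
      by (intro less_top[THEN iffD1] ennreal_suminf_neq_top) auto
  qed
  finally show ?thesis .
qed

text \<open>The same dyadic comparison with growing balls; the ratio is now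
  \<open>2 powr (real DIM('a) - \<beta>)\<close>.\<close>

lemma nn_integral_powr_far_finite:
  fixes \<beta> :: real
  assumes "real DIM('a::euclidean_space) < \<beta>"
  shows "(\<integral>\<^sup>+h. ennreal (norm h powr (- \<beta>)) * indicator (- cball (0::'a) 1) h \<partial>lborel) < top"
proof -
  let ?d = "DIM('a)" and ?\<omega> = "unit_ball_vol (real DIM('a))"
  have \<beta>: "0 < \<beta>" using assms by (rule le_less_trans[rotated]) simp
  let ?c = "\<lambda>j::nat. (2 ^ j) powr (- \<beta>)"
  have "(\<integral>\<^sup>+h. ennreal (norm h powr (- \<beta>)) * indicator (- cball (0::'a) 1) h \<partial>lborel)
    \<le> (\<integral>\<^sup>+h. (\<Sum>j. ennreal (?c j) * indicator (cball (0::'a) (2 ^ Suc j)) h) \<partial>lborel)"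
  proof (rule nn_integral_mono)
    fix h :: 'a
    show "ennreal (norm h powr (- \<beta>)) * indicator (- cball 0 1) h \<le> (\<Sum>j. ennreal (?c j) * indicator (cball (0::'a) (2 ^ Suc j)) h)"
    proof (cases "norm h > 1")
      case h: True
      define m where "m = (LEAST m. norm h < 2 ^ m)"
      obtain m' where "norm h < 2 ^ m'" using real_arch_pow[of 2 "norm h"] by auto
      then have m: "norm h < 2 ^ m" unfolding m_def by (rule LeastI)
      have "m \<noteq> 0" using m h by (cases m) auto
      then obtain j where j: "m = Suc j" by (cases m) auto
      then have "\<not> norm h < 2 ^ j" using not_less_Least[of j "\<lambda>m. norm h < 2 ^ m"] by (simp add: m_def)
      then have "norm h powr (- \<beta>) \<le> ?c j"
        using \<beta> by (intro powr_mono2') auto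
      then have "ennreal (norm h powr (- \<beta>)) \<le> ennreal (?c j) * indicator (cball (0::'a) (2 ^ Suc j)) h"
        using m j by (simp add: ennreal_leI)
      also have "\<dots> \<le> (\<Sum>j. ennreal (?c j) * indicator (cball (0::'a) (2 ^ Suc j)) h)"
        by (rule ennreal_le_suminf)
      finally have "ennreal (norm h powr (- \<beta>)) \<le> (\<Sum>j. ennreal (?c j) * indicator (cball (0::'a) (2 ^ Suc j)) h)" .
      then show ?thesis using h by (simp only: indicator_def Compl_iff mem_cball_0 not_le of_bool_def if_True mult_1_right)
    next
      case False
      then have "ennreal (norm h powr (- \<beta>)) * indicator (- cball 0 1) h = 0" by simp
      then show ?thesis by (simp only: zero_le)
    qed
  qed
  also have "\<dots> = (\<Sum>j. \<integral>\<^sup>+h. ennreal (?c j) * indicator (cball (0::'a) (2 ^ Suc j)) h \<partial>lborel)"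
    by (rule nn_integral_suminf) (simp add: borel_measurable_times_ennreal borel_measurable_indicator)
  also have "\<dots> = (\<Sum>j. ennreal (?c j * (?\<omega> * (2 ^ Suc j) ^ ?d)))"
    by (intro suminf_cong) (simp add: nn_integral_cmult_indicator emeasure_cball ennreal_mult'[symmetric])
  also have "\<dots> < top"
  proof -
    let ?q = "(2::real) powr (real ?d - \<beta>)"
    have geo: "?c j * (?\<omega> * (2 ^ Suc j) ^ ?d) = (?\<omega> * 2 ^ ?d) * ?q ^ j" for j
    proof -
      have "?c j * (2 ^ j) ^ ?d = ?q ^ j"
        by (simp add: powr_add[symmetric] powr_realpow[symmetric] powr_powr algebra_simps)
      then show ?thesis by (simp add: power_mult_distrib mult_ac)
    qed
    have "?q < 1" using powr_less_mono[of "real ?d - \<beta>" 0 2] assms by simp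
    then have "summable (\<lambda>j. (?\<omega> * 2 ^ ?d) * ?q ^ j)"
      by (intro summable_mult summable_geometric) auto
    then have "summable (\<lambda>j. ?c j * (?\<omega> * (2 ^ Suc j) ^ ?d))" unfolding geo .
    then show ?thesis
      by (intro less_top[THEN iffD1] ennreal_suminf_neq_top) auto
  qed
  finally show ?thesis .
qed

text \<open>Points that leave the ball lie in a shell of width \<open>norm h\<close>, and
  Bernoulli's inequality makes its volume linear in \<open>norm h\<close>. This gain of one power is
  what tames the kernel at the origin.\<close>

lemma exit_volume_ball_le:
  assumes "norm h \<le> 1"
  shows "exit_volume (ball (0::'a::euclidean_space) 1) h \<le> ennreal (unit_ball_vol (real DIM('a)) * DIM('a) * norm h)"
proof -
  let ?\<omega> = "unit_ball_vol (real DIM('a))"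
  have "exit_volume (ball (0::'a) 1) h \<le> emeasure lborel (ball 0 1 - ball (0::'a) (1 - norm h))"
    unfolding exit_volume_def
  proof (rule emeasure_mono)
    show "{x \<in> ball 0 1. x + h \<notin> ball 0 1} \<subseteq> ball 0 1 - ball (0::'a) (1 - norm h)"
    proof
      fix x assume "x \<in> {x \<in> ball 0 1. x + h \<notin> ball 0 1}"
      then show "x \<in> ball 0 1 - ball 0 (1 - norm h)" using norm_triangle_ineq[of x h] by auto
    qed
  qed simp
  also have "\<dots> = ennreal (?\<omega> - ?\<omega> * (1 - norm h) ^ DIM('a))"
  proof -
    have "ball 0 (1 - norm h) \<subseteq> ball (0::'a) 1" by (rule subset_ball) simp
    then show ?thesis using assms by (simp add: emeasure_Diff emeasure_ball ennreal_minus)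
  qed
  also have "\<dots> \<le> ennreal (?\<omega> * DIM('a) * norm h)"
  proof (rule ennreal_leI)
    have "1 - real DIM('a) * norm h \<le> (1 - norm h) ^ DIM('a)"
      using Bernoulli_inequality[of "- norm h" "DIM('a)"] assms by simp
    then have "?\<omega> * (1 - real DIM('a) * norm h) \<le> ?\<omega> * (1 - norm h) ^ DIM('a)"
      by (intro mult_left_mono) auto
    then show "?\<omega> - ?\<omega> * (1 - norm h) ^ DIM('a) \<le> ?\<omega> * DIM('a) * norm h"
      by (simp add: algebra_simps)
  qed
  finally show ?thesis .
qed

text \<open>Near \<open>0\<close> the integrand is of order \<open>norm h powr (- (s - 1))\<close>,
  integrable for \<open>s < DIM('a) + 1\<close>; far away the exit volume is bounded and
  \<open>DIM('a) < s\<close> suffices. With \<open>s = DIM('a) + \<alpha>\<close> these are the two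
  bounds on \<open>\<alpha>\<close>.\<close>

lemma per_ball_finite:
  assumes s: "real DIM('a::euclidean_space) < s" "s < real DIM('a) + 1"
  shows "per s (ball (0::'a) 1) < top"
proof -
  let ?\<omega> = "unit_ball_vol (real DIM('a))" and ?B = "ball (0::'a) 1"
  have d: "1 \<le> real DIM('a)" using DIM_positive[where 'a='a] by linarith
  have "exit_volume ?B h * kern s h
      \<le> ennreal (?\<omega> * DIM('a)) * (ennreal (norm h powr (- (s - 1))) * indicator (cball (0::'a) 1) h)
        + ennreal ?\<omega> * (ennreal (norm h powr (- s)) * indicator (- cball (0::'a) 1) h)" for h :: 'a
  proof -
    consider "h = 0" | "h \<noteq> 0" "norm h \<le> 1" | "norm h > 1" by linarith
    then show ?thesis
    proof cases
      case 1
      then have "exit_volume ?B h = 0" by (simp add: exit_volume_def)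
      then show ?thesis by simp
    next
      case 2
      then have "kern s h = ennreal (norm h powr (- s))"
        by (simp add: kern_def inverse_ennreal powr_minus)
      then have "exit_volume ?B h * kern s h \<le> ennreal (?\<omega> * DIM('a) * norm h) * ennreal (norm h powr (- s))"
        using exit_volume_ball_le[OF 2(2)] by (simp add: mult_right_mono)
      also have "\<dots> = ennreal (?\<omega> * DIM('a)) * ennreal (norm h powr (- (s - 1)))"
      proof -
        have "norm h * norm h powr (- s) = norm h powr (- (s - 1))"
          using 2 powr_add[of "norm h" 1 "- s"] by (simp add: powr_one)
        then show ?thesis by (simp add: ennreal_mult[symmetric] mult.assoc)
      qed
      finally show ?thesis using 2 by simp
    next
      case 3
      then have "h \<noteq> 0" by auto
      then have k: "kern s h = ennreal (norm h powr (- s))"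
        by (auto simp: kern_def inverse_ennreal powr_minus)
      have "exit_volume ?B h \<le> emeasure lborel ?B"
        unfolding exit_volume_def by (rule emeasure_mono) auto
      then have "exit_volume ?B h \<le> ennreal ?\<omega>" by (simp add: emeasure_ball)
      then have "exit_volume ?B h * kern s h \<le> ennreal ?\<omega> * ennreal (norm h powr (- s))"
        unfolding k by (rule mult_right_mono) simp
      then show ?thesis using 3 by simp
    qed
  qed
  then have "per s ?B \<le> (\<integral>\<^sup>+h. ennreal (?\<omega> * DIM('a)) * (ennreal (norm h powr (- (s - 1))) * indicator (cball (0::'a) 1) h)
        + ennreal ?\<omega> * (ennreal (norm h powr (- s)) * indicator (- cball (0::'a) 1) h) \<partial>lborel)"
    by (subst per_eq_exit_volume) (auto intro!: nn_integral_mono)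
  also have "\<dots> = ennreal (?\<omega> * DIM('a)) * (\<integral>\<^sup>+h. ennreal (norm h powr (- (s - 1))) * indicator (cball (0::'a) 1) h \<partial>lborel)
        + ennreal ?\<omega> * (\<integral>\<^sup>+h. ennreal (norm h powr (- s)) * indicator (- cball (0::'a) 1) h \<partial>lborel)"
  proof -
    have [simp]: "(\<lambda>h::'a. ennreal (norm h powr t) * indicator A h) \<in> borel_measurable borel" if "A \<in> sets borel" for t A
      using that by measurable
    show ?thesis
      by (subst nn_integral_add) (simp_all add: nn_integral_cmult borel_measurable_times_ennreal del: minus_diff_eq)
  qed
  also have "\<dots> < top"
    using nn_integral_powr_near_finite[where 'a='a, of "s - 1"] nn_integral_powr_far_finite[where 'a='a, of s] s d
    by (simp add: ennreal_mult_less_top)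
  finally show ?thesis .
qed

text \<open>Among sets of equal volume the ball of radius \<open>\<rho>\<close> is best, and scaling
  expresses its perimeter through that of the unit ball. A null set makes the left side
  \<open>0\<close>.\<close>

theorem fractional_isoperimetric:
  fixes E :: "'a::euclidean_space set"
  assumes E: "E \<in> sets borel" "bounded E" and \<alpha>: "0 < \<alpha>" "\<alpha> < 1"
  shows "ennreal (measure lborel E powr ((real DIM('a) - \<alpha>) / real DIM('a)))
    \<le> ennreal (unit_ball_vol (real DIM('a)) powr ((real DIM('a) - \<alpha>) / real DIM('a)))
        / per (real DIM('a) + \<alpha>) (ball (0::'a) 1) * per (real DIM('a) + \<alpha>) E"
proof (cases "measure lborel E = 0")
  case False
  let ?d = "real DIM('a)" and ?\<omega> = "unit_ball_vol (real DIM('a))"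
  let ?P = "per (?d + \<alpha>) (ball (0::'a) 1)"
  have d: "1 \<le> ?d" using DIM_positive[where 'a='a] by linarith
  define v where "v = measure lborel E"
  have v: "0 < v" using False by (simp add: v_def order_less_le)
  have Efin: "emeasure lborel E = ennreal v"
    using emeasure_bounded_finite[OF E(2)] by (simp add: v_def emeasure_eq_ennreal_measure less_top)
  have w: "0 < ?\<omega>" "?\<omega> \<noteq> 0" using unit_ball_vol_pos[of ?d] by (simp_all del: unit_ball_vol_pos)
  define \<rho> where "\<rho> = (v / ?\<omega>) powr (1 / ?d)"
  have \<rho>: "0 < \<rho>" using v w by (simp add: \<rho>_def)
  have "\<rho> ^ DIM('a) = v / ?\<omega>"
    using \<rho> v d w by (simp add: powr_realpow[symmetric] \<rho>_def powr_powr)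
  then have vol: "emeasure lborel E = emeasure lborel (ball (0::'a) \<rho>)"
    using \<rho> Efin w by (simp add: emeasure_ball)
  have "ennreal (v powr ((?d - \<alpha>) / ?d)) = ennreal (?\<omega> powr ((?d - \<alpha>) / ?d)) * ennreal (\<rho> powr (?d - \<alpha>))"
  proof -
    have "v powr ((?d - \<alpha>) / ?d) = (?\<omega> * (v / ?\<omega>)) powr ((?d - \<alpha>) / ?d)"
      using w by simp
    also have "\<dots> = ?\<omega> powr ((?d - \<alpha>) / ?d) * \<rho> powr (?d - \<alpha>)"
      using v by (subst powr_mult) (auto simp: \<rho>_def powr_powr)
    finally show ?thesis by (simp add: ennreal_mult)
  qed
  also have "ennreal (\<rho> powr (?d - \<alpha>)) = per (?d + \<alpha>) (ball (0::'a) \<rho>) / ?P"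
  proof -
    have P: "?P \<noteq> 0" "?P \<noteq> top"
      using per_ball_pos[where 'a='a, of "?d + \<alpha>"] per_ball_finite[where 'a='a, of "?d + \<alpha>"] \<alpha> by auto
    have "2 * ?d - (?d + \<alpha>) = ?d - \<alpha>" by simp
    then have "per (?d + \<alpha>) (ball (0::'a) \<rho>) = ennreal (\<rho> powr (?d - \<alpha>)) * ?P"
      using per_ball_scale[OF \<rho>, where 'a='a, of "?d + \<alpha>"] by simp
    then show ?thesis using P
      by (simp add: ennreal_mult_divide_eq)
  qed
  also have "ennreal (?\<omega> powr ((?d - \<alpha>) / ?d)) * (per (?d + \<alpha>) (ball (0::'a) \<rho>) / ?P)
      \<le> ennreal (?\<omega> powr ((?d - \<alpha>) / ?d)) * (per (?d + \<alpha>) E / ?P)"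
    using per_ball_le[OF E vol \<rho>] \<alpha> by (intro mult_left_mono divide_right_mono_ennreal) auto
  also have "\<dots> = ennreal (?\<omega> powr ((?d - \<alpha>) / ?d)) / ?P * per (?d + \<alpha>) E"
    by (simp add: divide_ennreal_def mult_ac)
  finally show ?thesis by (simp add: v_def)
qed simp

subsection \<open>Coarea formula and level sets\<close>

text \<open>The range of \<open>t\<close> may be all of \<open>\<real>\<close>: the level sets of \<open>f\<close> below its minimum contribute \<open>0\<close>.\<close>
lemma seminorm_coarea:
  fixes f :: "'a::euclidean_space \<Rightarrow> real"
  assumes [measurable]: "f \<in> borel_measurable borel"
  shows "seminorm s f = (\<integral>\<^sup>+t. 2 * per s {x. t < f x} \<partial>lborel)"
proof -
  \<comment> \<open>\<open>D\<close> has two readings: integrated over \<open>t\<close> it is the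
    difference of values of \<open>f\<close>, and for fixed \<open>t\<close> it is the same
    difference for the indicator of a superlevel set. Fubini exchanges them.\<close>
  define D :: "real \<Rightarrow> 'a \<Rightarrow> 'a \<Rightarrow> ennreal" where
    "D t h x = (if t < f (x + h) \<and> t \<ge> f x \<or> t < f x \<and> t \<ge> f (x + h) then 1 else 0)" for t h x
  have D1: "(\<integral>\<^sup>+t. D t h x \<partial>lborel) = ennreal \<bar>f (x + h) - f x\<bar>" for h x
  proof -
    have "(\<integral>\<^sup>+t. D t h x \<partial>lborel) = (\<integral>\<^sup>+t. indicator {min (f (x + h)) (f x)..<max (f (x + h)) (f x)} t \<partial>lborel)"
      by (intro nn_integral_cong) (auto simp: D_def indicator_def)
    also have "\<dots> = ennreal \<bar>f (x + h) - f x\<bar>"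
      by (simp add: min_def max_def)
    finally show ?thesis .
  qed
  have D2: "D t h x = ennreal \<bar>indicator {x. t < f x} (x + h) - indicator {x. t < f x} x\<bar>" for t h x
    by (auto simp: D_def indicator_def)
  have [measurable]: "(\<lambda>(x, t). D t h x) \<in> borel_measurable (borel \<Otimes>\<^sub>M borel)" for h
    unfolding D_def[abs_def] by measurable
  have [measurable]: "(\<lambda>q. D (fst (fst q)) (snd (fst q)) (snd q)) \<in> borel_measurable ((borel \<Otimes>\<^sub>M borel) \<Otimes>\<^sub>M borel)"
    unfolding D_def[abs_def] by measurable
  have [measurable]: "(\<lambda>x. D t h x) \<in> borel_measurable borel" for t h
    unfolding D_def[abs_def] by measurable
  have [measurable]: "(\<lambda>p. \<integral>\<^sup>+x. D (fst p) (snd p) x \<partial>lborel) \<in> borel_measurable (borel \<Otimes>\<^sub>M borel)"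
  proof -
    have "(\<lambda>p. \<integral>\<^sup>+x. (\<lambda>q. D (fst (fst q)) (snd (fst q)) (snd q)) (p, x) \<partial>lborel) \<in> borel_measurable (borel \<Otimes>\<^sub>M borel)"
      by measurable
    then show ?thesis by simp
  qed
  have "seminorm s f = (\<integral>\<^sup>+h. (\<integral>\<^sup>+x. \<integral>\<^sup>+t. D t h x \<partial>lborel \<partial>lborel) * kern s h \<partial>lborel)"
    by (simp add: seminorm_def D1)
  also have "\<dots> = (\<integral>\<^sup>+h. (\<integral>\<^sup>+t. \<integral>\<^sup>+x. D t h x \<partial>lborel \<partial>lborel) * kern s h \<partial>lborel)"
    by (intro nn_integral_cong arg_cong2[where f="(*)"] refl lborel_pair.Fubini'[symmetric]) measurable
  also have "\<dots> = (\<integral>\<^sup>+h. \<integral>\<^sup>+t. (\<integral>\<^sup>+x. D t h x \<partial>lborel) * kern s h \<partial>lborel \<partial>lborel)"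
    by (intro nn_integral_cong nn_integral_multc[symmetric]) measurable
  also have "\<dots> = (\<integral>\<^sup>+t. \<integral>\<^sup>+h. (\<integral>\<^sup>+x. D t h x \<partial>lborel) * kern s h \<partial>lborel \<partial>lborel)"
    by (rule lborel_pair.Fubini') measurable
  also have "\<dots> = (\<integral>\<^sup>+t. 2 * per s {x. t < f x} \<partial>lborel)"
  proof (rule nn_integral_cong)
    fix t
    have "{x. t < f x} \<in> sets borel" by measurable
    from seminorm_indicator[OF this, of s]
    show "(\<integral>\<^sup>+h. (\<integral>\<^sup>+x. D t h x \<partial>lborel) * kern s h \<partial>lborel) = 2 * per s {x. t < f x}"
      unfolding D2 by (simp add: seminorm_def)
  qed
  finally show ?thesis .
qed

lemma seminorm_abs_le: "seminorm s (\<lambda>x. \<bar>f x\<bar>) \<le> seminorm s f"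
  unfolding seminorm_def by (intro nn_integral_mono mult_right_mono ennreal_leI) auto

text \<open>Hoelder's inequality for \<open>u powr (p - 1)\<close> and the indicator of
  \<open>E\<close>, with exponents \<open>p / (p - 1)\<close> and \<open>p\<close>.\<close>

lemma nn_integral_powr_Hoelder:
  fixes u :: "'a::euclidean_space \<Rightarrow> real"
  assumes [measurable]: "u \<in> borel_measurable borel" "E \<in> sets borel"
    and pos: "\<And>x. x \<in> E \<Longrightarrow> 0 < u x" and p: "1 < p"
    and I: "(\<integral>\<^sup>+x. ennreal (u x powr p) \<partial>lborel) = ennreal I" "0 < I"
    and A: "emeasure lborel E = ennreal A" "0 \<le> A"
  shows "(\<integral>\<^sup>+x. ennreal (u x powr (p - 1)) * indicator E x \<partial>lborel)
    \<le> ennreal (I powr ((p - 1) / p)) * ennreal (A powr (1 / p))"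
proof (cases "A = 0")
  case True
  then have "AE x in lborel. x \<notin> E" using A by (intro AE_not_in) (auto simp: null_sets_def)
  then have "(\<integral>\<^sup>+x. ennreal (u x powr (p - 1)) * indicator E x \<partial>lborel) = (\<integral>\<^sup>+x. 0 \<partial>(lborel :: 'a measure))"
    by (intro nn_integral_cong_AE) (auto elim: eventually_mono)
  then show ?thesis by simp
next
  case False
  then have A0: "0 < A" using A by simp
  let ?q = "(p - 1) / p" and ?C = "I powr ((p - 1) / p) * A powr (1 / p)"
  have C: "0 < ?C" using I A0 by simp
  \<comment> \<open>Young's inequality for the normalized quantities \<open>u x powr p / I\<close>
    and \<open>1 / A\<close>; after integration the two terms contribute \<open>(p - 1) / p\<close>
    and \<open>1 / p\<close>, with sum 1.\<close>
  have young: "u x powr (p - 1) \<le> ?C * (?q / I * u x powr p + (1 / p) / A)" if "x \<in> E" for x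
  proof -
    have ux: "0 < u x" using pos[OF that] .
    have "(u x powr p / I) powr ?q * (1 / A) powr (1 / p) \<le> ?q * (u x powr p / I) + 1 / p * (1 / A)"
      using ux I(2) A0 p by (intro Youngs_inequality_0) (auto simp: field_simps)
    moreover have "(u x powr p / I) powr ?q * (1 / A) powr (1 / p) = u x powr (p - 1) / ?C"
      using ux I(2) A0 p by (simp add: powr_divide powr_powr)
    ultimately show ?thesis using C by (simp add: field_simps)
  qed
  have "(\<integral>\<^sup>+x. ennreal (u x powr (p - 1)) * indicator E x \<partial>lborel)
    \<le> (\<integral>\<^sup>+x. ennreal ?C * (ennreal (?q / I) * ennreal (u x powr p) + ennreal ((1 / p) / A) * indicator E x) \<partial>lborel)"
  proof (rule nn_integral_mono)
    fix x
    show "ennreal (u x powr (p - 1)) * indicator E x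
      \<le> ennreal ?C * (ennreal (?q / I) * ennreal (u x powr p) + ennreal ((1 / p) / A) * indicator E x)"
    proof (cases "x \<in> E")
      case True
      have "ennreal (u x powr (p - 1)) \<le> ennreal (?C * (?q / I * u x powr p + (1 / p) / A))"
        by (rule ennreal_leI[OF young[OF True]])
      also have "\<dots> = ennreal ?C * (ennreal (?q / I) * ennreal (u x powr p) + ennreal ((1 / p) / A))"
      proof -
        have nn: "0 \<le> ?q / I" "0 \<le> (1 / p) / A" "0 \<le> ?q / I * u x powr p" using p I(2) A0 by auto
        then show ?thesis using C
          by (simp only: ennreal_mult[OF less_imp_le[OF C] add_nonneg_nonneg[OF nn(3) nn(2)]]
              ennreal_plus[OF nn(3) nn(2)] ennreal_mult[OF nn(1) powr_ge_zero])
      qed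
      finally show ?thesis using True by simp
    qed simp
  qed
  also have "\<dots> = ennreal ?C * (ennreal (?q / I) * ennreal I + ennreal ((1 / p) / A) * ennreal A)"
    by (subst nn_integral_cmult, measurable, subst nn_integral_add) (auto simp: nn_integral_cmult I A)
  also have "ennreal (?q / I) * ennreal I + ennreal ((1 / p) / A) * ennreal A = 1"
  proof -
    have "ennreal (?q / I) * ennreal I = ennreal ?q" "ennreal ((1 / p) / A) * ennreal A = ennreal (1 / p)"
      using p I(2) A0 by (simp_all flip: ennreal_mult)
    moreover have "ennreal ?q + ennreal (1 / p) = ennreal 1"
      using p by (subst ennreal_plus[symmetric]) (auto simp: diff_divide_distrib)
    ultimately show ?thesis by simp
  qed
  finally show ?thesis by (simp add: ennreal_mult)
qed

text \<open>Write \<open>u\<^sup>p = \<integral>\<^sub>0\<^sup>\<infinity> u\<^sup>p\<^sup>-\<^sup>1 1\<^bsub>{u > t}\<^esub> dt\<close> and apply Hoelder's inequality on each level set.\<close>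
lemma Lp_le_nn_integral_level_sets:
  fixes u :: "'a::euclidean_space \<Rightarrow> real"
  assumes [measurable]: "u \<in> borel_measurable borel" and u: "\<And>x. 0 \<le> u x" and p: "1 < p"
    and I: "(\<integral>\<^sup>+x. ennreal (u x powr p) \<partial>lborel) = ennreal I" "0 \<le> I"
    and fin: "\<And>t. 0 < t \<Longrightarrow> emeasure lborel {x. t < u x} < top"
  shows "ennreal (I powr (1 / p))
    \<le> (\<integral>\<^sup>+t. ennreal (measure lborel {x. t < u x} powr (1 / p)) * indicator {0<..} t \<partial>lborel)" (is "_ \<le> ?W")
proof (cases "I = 0")
  case False
  then have I0: "0 < I" using I by simp
  let ?J = "I powr ((p - 1) / p)"
  define G where "G x t = ennreal (u x powr (p - 1)) * (if 0 < t \<and> t < u x then 1 else 0)" for x t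
  have [measurable]: "case_prod G \<in> borel_measurable (borel \<Otimes>\<^sub>M borel)"
    unfolding G_def[abs_def] by measurable
  have "ennreal I = (\<integral>\<^sup>+x. \<integral>\<^sup>+t. G x t \<partial>lborel \<partial>lborel)"
    unfolding I(1)[symmetric]
  proof (rule nn_integral_cong)
    fix x
    have "(\<integral>\<^sup>+t. G x t \<partial>lborel) = (\<integral>\<^sup>+t. ennreal (u x powr (p - 1)) * indicator {0<..<u x} t \<partial>lborel)"
      by (intro nn_integral_cong) (auto simp: G_def indicator_def)
    also have "\<dots> = ennreal (u x powr (p - 1)) * ennreal (u x)"
      using u[of x] by (simp add: nn_integral_cmult_indicator)
    also have "\<dots> = ennreal (u x powr p)"
      using u[of x] powr_add[of "u x" "p - 1" 1] by (cases "u x = 0") (auto simp: ennreal_mult[symmetric])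
    finally show "ennreal (u x powr p) = (\<integral>\<^sup>+t. G x t \<partial>lborel)" by simp
  qed
  also have "\<dots> = (\<integral>\<^sup>+t. \<integral>\<^sup>+x. G x t \<partial>lborel \<partial>lborel)"
    by (rule lborel_pair.Fubini'[symmetric]) measurable
  also have "\<dots> \<le> (\<integral>\<^sup>+t. ennreal ?J * (ennreal (measure lborel {x. t < u x} powr (1 / p)) * indicator {0<..} t) \<partial>lborel)"
  proof (rule nn_integral_mono)
    fix t :: real
    show "(\<integral>\<^sup>+x. G x t \<partial>lborel) \<le> ennreal ?J * (ennreal (measure lborel {x. t < u x} powr (1 / p)) * indicator {0<..} t)"
    proof (cases "0 < t")
      case True
      have "(\<integral>\<^sup>+x. G x t \<partial>lborel) = (\<integral>\<^sup>+x. ennreal (u x powr (p - 1)) * indicator {x. t < u x} x \<partial>lborel)"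
        using True by (intro nn_integral_cong) (auto simp: G_def indicator_def)
      also have "\<dots> \<le> ennreal ?J * ennreal (measure lborel {x. t < u x} powr (1 / p))"
        using True fin[OF True] p I(1) I0
        by (intro nn_integral_powr_Hoelder) (auto simp: emeasure_eq_ennreal_measure less_top)
      finally show ?thesis using True by simp
    qed (simp add: G_def)
  qed
  also have "\<dots> \<le> ennreal ?J * ?W"
  proof (rule eq_refl, rule nn_integral_cmult)
    have "(\<lambda>t. \<integral>\<^sup>+x. (if t < u x then 1 else 0) \<partial>(lborel :: 'a measure)) \<in> borel_measurable borel"
      by measurable
    moreover have "(\<integral>\<^sup>+x. (if t < u x then 1 else 0) \<partial>lborel) = emeasure lborel {x. t < u x}" for t
    proof -
      have "(\<integral>\<^sup>+x. (if t < u x then 1 else 0) \<partial>lborel) = (\<integral>\<^sup>+x. indicator {x. t < u x} x \<partial>lborel)"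
        by (intro nn_integral_cong) (auto simp: indicator_def)
      also have "\<dots> = emeasure lborel {x. t < u x}" by (rule nn_integral_indicator) measurable
      finally show ?thesis .
    qed
    ultimately have [measurable]: "(\<lambda>t. emeasure lborel {x. t < u x}) \<in> borel_measurable borel" by simp
    show "(\<lambda>t. ennreal (measure lborel {x. t < u x} powr (1 / p)) * indicator {0<..} t) \<in> borel_measurable lborel"
      unfolding measure_def by measurable
  qed
  \<comment> \<open>So far \<open>I \<le> ?J * ?W\<close> with \<open>?J\<close> a power of
    \<open>I\<close> of exponent \<open>1 - 1 / p\<close>; as \<open>I\<close> is positive and
    finite, division leaves the power \<open>1 / p\<close>.\<close>
  finally have "ennreal (1 / ?J) * ennreal I \<le> ennreal (1 / ?J) * (ennreal ?J * ?W)"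
    by (intro mult_left_mono) auto
  also have "ennreal (1 / ?J) * (ennreal ?J * ?W) = ?W"
    using I0 by (simp add: mult.assoc[symmetric] ennreal_mult[symmetric])
  also have "ennreal (1 / ?J) * ennreal I = ennreal (I powr (1 / p))"
  proof -
    have "I powr (1 / p) * ?J = I powr 1"
      using p by (subst powr_add[symmetric]) (auto simp: diff_divide_distrib)
    then have "1 / ?J * I = I powr (1 / p)" using I0 by (simp add: field_simps)
    then show ?thesis using I0 by (simp flip: ennreal_mult)
  qed
  finally show ?thesis .
qed (use p in simp)

subsection \<open>Smooth radial bumps\<close>

text \<open>With \<open>p = 1\<close> this is the classical \<open>exp (- 1 / x)\<close> extended by
  \<open>0\<close>. The polynomial in \<open>1 / x\<close> makes the family closed under
  differentiation.\<close>

definition flat :: "real poly \<Rightarrow> real \<Rightarrow> real" where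
  "flat p x = (if 0 < x then poly p (1 / x) * exp (- (1 / x)) else 0)"

lemma poly_mult_exp_neg_tendsto_0: "((\<lambda>y. poly p y * exp (- y)) \<longlongrightarrow> 0) (at_top :: real filter)"
proof -
  have "((\<lambda>y. \<Sum>i\<le>degree p. coeff p i * (y ^ i / exp y)) \<longlongrightarrow> (\<Sum>i\<le>degree p. coeff p i * 0)) at_top"
    by (intro tendsto_intros tendsto_power_div_exp_0)
  then show ?thesis
    by (simp add: poly_altdef sum_distrib_right exp_minus divide_inverse mult.assoc)
qed

lemma flat_has_derivative_0: "(flat p has_real_derivative 0) (at 0)"
proof -
  have "((\<lambda>h. flat p h / h) \<longlongrightarrow> 0) (at_right 0)"
  proof -
    \<comment> \<open>\<open>pCons 0 p\<close> is \<open>p\<close> times its variable; the extra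
      factor \<open>inverse h\<close> is the denominator of the difference quotient.\<close>
    have "((\<lambda>h. poly (pCons 0 p) (inverse h) * exp (- inverse h)) \<longlongrightarrow> 0) (at_right (0::real))"
      by (rule filterlim_compose[OF poly_mult_exp_neg_tendsto_0 filterlim_inverse_at_top_right])
    moreover have "\<forall>\<^sub>F h in at_right (0::real). poly (pCons 0 p) (inverse h) * exp (- inverse h) = flat p h / h"
      by (intro eventually_at_rightI[of 0 1]) (auto simp: flat_def field_simps)
    ultimately show ?thesis by (rule Lim_transform_eventually)
  qed
  moreover have "((\<lambda>h. flat p h / h) \<longlongrightarrow> 0) (at_left 0)"
    by (rule Lim_transform_eventually[OF tendsto_const])
       (intro eventually_at_leftI[of "-1"], auto simp: flat_def)
  ultimately have "((\<lambda>h. flat p h / h) \<longlongrightarrow> 0) (at 0)"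
    by (simp add: filterlim_at_split)
  then show ?thesis by (simp add: DERIV_def flat_def)
qed

text \<open>In \<open>y = 1 / x\<close> differentiation is \<open>- y^2 d/dy\<close>, and it takes
  \<open>p(y) exp(-y)\<close> to \<open>y^2 (p(y) - p'(y)) exp(-y)\<close>.\<close>

lemma flat_has_derivative:
  "(flat p has_real_derivative flat ([:0, 0, 1:] * (p - pderiv p)) x) (at x)"
proof -
  consider "x = 0" | "x < 0" | "x > 0" by linarith
  then show ?thesis
  proof cases
    case 1
    then show ?thesis using flat_has_derivative_0[of p] by (simp add: flat_def)
  next
    case 2
    have "\<forall>\<^sub>F y in nhds x. y \<in> {..<0}" using 2 by (intro eventually_nhds_in_open) auto
    then have "\<forall>\<^sub>F y in nhds x. flat p y = 0" by eventually_elim (simp add: flat_def)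
    then show ?thesis using 2 by (subst DERIV_cong_ev[OF refl _ refl, of _ "\<lambda>_. 0"]) (auto simp: flat_def)
  next
    case 3
    have "\<forall>\<^sub>F y in nhds x. y \<in> {0<..}" using 3 by (intro eventually_nhds_in_open) auto
    then have ev: "\<forall>\<^sub>F y in nhds x. flat p y = poly p (1 / y) * exp (- (1 / y))"
      by eventually_elim (simp add: flat_def)
    have "((\<lambda>y. poly p (1 / y) * exp (- (1 / y))) has_real_derivative flat ([:0, 0, 1:] * (p - pderiv p)) x) (at x)"
    proof -
      have 1: "((\<lambda>y. 1 / y) has_real_derivative - (1 / x\<^sup>2)) (at x)"
        using 3 by (auto intro!: derivative_eq_intros simp: power2_eq_square)
      have 2: "((\<lambda>y. poly p (1 / y)) has_real_derivative poly (pderiv p) (1 / x) * (- (1 / x\<^sup>2))) (at x)"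
        by (rule DERIV_chain2[OF poly_DERIV 1])
      have 3: "((\<lambda>y. exp (- (1 / y))) has_real_derivative exp (- (1 / x)) * (- (- (1 / x\<^sup>2)))) (at x)"
        by (rule DERIV_chain2[OF DERIV_exp DERIV_minus[OF 1]])
      show ?thesis
        by (rule DERIV_cong[OF DERIV_mult[OF 2 3]])
           (use \<open>x > 0\<close> in \<open>simp add: flat_def power2_eq_square left_diff_distrib right_diff_distrib mult_ac\<close>)
    qed
    then show ?thesis by (subst DERIV_cong_ev[OF refl ev refl])
  qed
qed

text \<open>A class of differentiable functions that contains the directional derivatives of its members.\<close>
inductive smooth_fun :: "('a::real_inner \<Rightarrow> real) \<Rightarrow> bool" where
  const: "smooth_fun (\<lambda>x. c)"
| inner: "smooth_fun (\<lambda>x. x \<bullet> v)"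
| square: "smooth_fun (\<lambda>x. x \<bullet> x)"
| add: "smooth_fun f \<Longrightarrow> smooth_fun g \<Longrightarrow> smooth_fun (\<lambda>x. f x + g x)"
| mult: "smooth_fun f \<Longrightarrow> smooth_fun g \<Longrightarrow> smooth_fun (\<lambda>x. f x * g x)"
| inv: "smooth_fun f \<Longrightarrow> (\<And>x. f x \<noteq> 0) \<Longrightarrow> smooth_fun (\<lambda>x. inverse (f x))"
| flat: "smooth_fun f \<Longrightarrow> smooth_fun (\<lambda>x. flat p (f x))"

lemma smooth_fun_has_derivative:
  assumes "smooth_fun f"
  obtains D where "\<And>x. (f has_derivative D x) (at x)" "\<And>v. smooth_fun (\<lambda>x. D x v)"
proof -
  from assms have "\<exists>D. (\<forall>x. (f has_derivative D x) (at x)) \<and> (\<forall>v. smooth_fun (\<lambda>x. D x v))"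
  proof induction
    case (const c)
    show ?case by (intro exI[of _ "\<lambda>x v. 0"]) (auto intro: smooth_fun.const)
  next
    case (inner v)
    have "((\<lambda>x. x \<bullet> v) has_derivative (\<lambda>w. w \<bullet> v)) (at x)" for x
      by (auto intro!: derivative_eq_intros)
    then show ?case by (intro exI[of _ "\<lambda>x w. w \<bullet> v"]) (auto intro: smooth_fun.const)
  next
    case square
    have "((\<lambda>x. x \<bullet> x) has_derivative (\<lambda>w. 2 * (x \<bullet> w))) (at x)" for x :: 'a
      by (auto intro!: derivative_eq_intros simp: inner_commute)
    then show ?case
      by (intro exI[of _ "\<lambda>x w. 2 * (x \<bullet> w)"]) (auto intro: smooth_fun.intros)
  next
    case (add f g)
    then obtain D E where "\<And>x. (f has_derivative D x) (at x)" "\<And>v. smooth_fun (\<lambda>x. D x v)"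
      "\<And>x. (g has_derivative E x) (at x)" "\<And>v. smooth_fun (\<lambda>x. E x v)" by blast
    then show ?case
      by (intro exI[of _ "\<lambda>x v. D x v + E x v"]) (auto intro: smooth_fun.intros has_derivative_add)
  next
    case (mult f g)
    then obtain D E where "\<And>x. (f has_derivative D x) (at x)" "\<And>v. smooth_fun (\<lambda>x. D x v)"
      "\<And>x. (g has_derivative E x) (at x)" "\<And>v. smooth_fun (\<lambda>x. E x v)" by blast
    moreover from this have "smooth_fun (\<lambda>x. f x * E x v + D x v * g x)" for v
      using mult.hyps by (intro smooth_fun.add smooth_fun.mult) auto
    ultimately show ?case
      by (intro exI[of _ "\<lambda>x v. f x * E x v + D x v * g x"]) (auto intro: has_derivative_mult)
  next
    case (inv f)
    then obtain D where D: "\<And>x. (f has_derivative D x) (at x)" "\<And>v. smooth_fun (\<lambda>x. D x v)" by blast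
    have "smooth_fun (\<lambda>x. (- 1) * (inverse (f x) * D x v * inverse (f x)))" for v
      using inv D by (intro smooth_fun.intros)
    then show ?case using inv D
      by (intro exI[of _ "\<lambda>x v. - (inverse (f x) * D x v * inverse (f x))"]) (auto intro: has_derivative_inverse)
  next
    case (flat f p)
    then obtain D where D: "\<And>x. (f has_derivative D x) (at x)" "\<And>v. smooth_fun (\<lambda>x. D x v)" by blast
    let ?q = "[:0, 0, 1:] * (p - pderiv p)"
    have "((\<lambda>x. flat p (f x)) has_derivative (\<lambda>v. flat ?q (f x) * D x v)) (at x)" for x
      using has_derivative_compose[OF D(1) flat_has_derivative[unfolded has_field_derivative_def]] by simp
    then show ?case using flat D
      by (intro exI[of _ "\<lambda>x v. flat ?q (f x) * D x v"]) (auto intro: smooth_fun.intros)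
  qed
  then show thesis using that by blast
qed

lemma smooth_fun_imp_smooth_on:
  assumes "smooth_fun f" shows "smooth_on f S"
proof -
  have "Ck_on k f S" if "smooth_fun f" for k f
    using that
  proof (induction k arbitrary: f)
    case 0
    obtain D where D: "\<And>x. (f has_derivative D x) (at x)" "\<And>v. smooth_fun (\<lambda>x. D x v)"
      by (rule smooth_fun_has_derivative[OF 0]) (rule that)
    then show ?case
      by (auto intro!: continuous_at_imp_continuous_on has_derivative_continuous)
  next
    case (Suc k)
    obtain D where D: "\<And>x. (f has_derivative D x) (at x)" "\<And>v. smooth_fun (\<lambda>x. D x v)"
      by (rule smooth_fun_has_derivative[OF Suc.prems]) (rule that)
    then have "frechet_derivative f (at x) = D x" for x
      using frechet_derivative_at[OF D(1)] by simp
    then show ?case using D Suc.IH by (auto intro: differentiableI)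
  qed
  then show ?thesis using assms by (simp add: smooth_on_def)
qed

lemma flat_1_mono: "x \<le> y \<Longrightarrow> flat 1 x \<le> flat 1 y"
  by (auto simp: flat_def frac_le)

lemma flat_1_pos_iff: "0 < flat 1 x \<longleftrightarrow> 0 < x"
  by (simp add: flat_def)

lemma flat_1_nonneg: "0 \<le> flat 1 x"
  by (simp add: flat_def)

text \<open>The standard smooth step, taken in the variable \<open>x \<bullet> x\<close> to stay
  smooth at the origin: it is 1 on the closed unit ball and 0 where
  \<open>b \<le> x \<bullet> x\<close>.\<close>

definition bump :: "real \<Rightarrow> 'a::real_inner \<Rightarrow> real" where
  "bump b x = flat 1 (b - x \<bullet> x) * inverse (flat 1 (b - x \<bullet> x) + flat 1 (x \<bullet> x - 1))"

lemma bump_denominator_pos: "1 < b \<Longrightarrow> 0 < flat 1 (b - r) + flat 1 (r - 1)"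
  by (cases "r < b") (auto intro: add_pos_nonneg add_nonneg_pos simp: flat_1_pos_iff flat_1_nonneg)

lemma smooth_fun_bump:
  assumes "1 < b" shows "smooth_fun (bump b)"
proof -
  have "smooth_fun (\<lambda>x::'a. flat 1 (b + (- 1) * (x \<bullet> x)))" "smooth_fun (\<lambda>x::'a. flat 1 (x \<bullet> x + (- 1)))"
    by (intro smooth_fun.intros)+
  then have *: "smooth_fun (\<lambda>x::'a. flat 1 (b - x \<bullet> x))" "smooth_fun (\<lambda>x::'a. flat 1 (x \<bullet> x - 1))"
    by simp_all
  show ?thesis
    unfolding bump_def[abs_def]
    by (intro smooth_fun.mult smooth_fun.inv smooth_fun.add *) (metis bump_denominator_pos[OF assms] less_irrefl)
qed

lemma bump_eq_1: "norm x \<le> 1 \<Longrightarrow> 1 < b \<Longrightarrow> bump b x = 1"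
  using abs_square_le_1[of "norm x"] by (auto simp: bump_def flat_def dot_square_norm)

lemma bump_eq_0: "b \<le> x \<bullet> x \<Longrightarrow> bump b x = 0"
  by (simp add: bump_def flat_def)

lemma bump_nonneg: "1 < b \<Longrightarrow> 0 \<le> bump b x"
  using bump_denominator_pos[of b "x \<bullet> x"] by (simp add: bump_def flat_1_nonneg)

lemma bump_le_1: "1 < b \<Longrightarrow> bump b x \<le> 1"
  using bump_denominator_pos[of b "x \<bullet> x"] flat_1_nonneg[of "x \<bullet> x - 1"]
  by (simp add: bump_def field_simps)

lemma bump_antimono:
  assumes "1 < b" "norm x \<le> norm y" shows "bump b y \<le> bump b x"
proof -
  have xy: "x \<bullet> x \<le> y \<bullet> y" using assms by (simp add: norm_le)
  have A: "flat 1 (b - y \<bullet> y) \<le> flat 1 (b - x \<bullet> x)" and B: "flat 1 (x \<bullet> x - 1) \<le> flat 1 (y \<bullet> y - 1)"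
    using xy by (auto intro: flat_1_mono)
  have "flat 1 (b - y \<bullet> y) * flat 1 (x \<bullet> x - 1) \<le> flat 1 (b - x \<bullet> x) * flat 1 (y \<bullet> y - 1)"
    by (intro mult_mono A B flat_1_nonneg)
  then have "flat 1 (b - y \<bullet> y) * (flat 1 (b - x \<bullet> x) + flat 1 (x \<bullet> x - 1))
    \<le> flat 1 (b - x \<bullet> x) * (flat 1 (b - y \<bullet> y) + flat 1 (y \<bullet> y - 1))"
    by (simp add: distrib_left mult.commute)
  then show ?thesis
    unfolding bump_def divide_inverse[symmetric]
    by (subst pos_divide_le_eq[OF bump_denominator_pos[OF assms(1)]], subst times_divide_eq_left,
        subst pos_le_divide_eq[OF bump_denominator_pos[OF assms(1)]])
qed

text \<open>The radius is the supremum of the norms. Openness lets every point be pushed outwards,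
  so the supremum is not attained and the ball is open.\<close>

lemma open_radial_set_eq_ball:
  fixes E :: "'a::euclidean_space set"
  assumes "open E" "bounded E" "0 \<in> E" and down: "\<And>x y. x \<in> E \<Longrightarrow> norm y \<le> norm x \<Longrightarrow> y \<in> E"
  obtains r where "0 < r" "E = ball 0 r"
proof
  define r where "r = Sup (norm ` E)"
  have bdd: "bdd_above (norm ` E)" using assms(2) by (auto simp: bounded_iff bdd_above_def)
  have ex: "\<exists>y\<in>E. norm x < norm y" if xE: "x \<in> E" for x
  proof -
    obtain e where e: "e > 0" "ball x e \<subseteq> E" by (rule openE[OF assms(1) xE]) (rule that)
    obtain b :: 'a where b: "b \<in> Basis" using nonempty_Basis by blast
    \<comment> \<open>The outward direction at \<open>x\<close>; at the origin \<open>sgn\<close> is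
      \<open>0\<close>, so any unit vector is taken instead.\<close>
    define u where "u = (if x = 0 then b else sgn x)"
    have u: "norm u = 1" using b by (auto simp: u_def norm_sgn)
    have "dist x (x + (e / 2) *\<^sub>R u) < e" unfolding dist_norm using e(1) u by simp
    then have "x + (e / 2) *\<^sub>R u \<in> E" using e(2) by (simp only: subset_iff mem_ball)
    moreover have "norm x < norm (x + (e / 2) *\<^sub>R u)"
    proof (cases "x = 0")
      case False
      have "(e / 2) *\<^sub>R u = (e / 2 / norm x) *\<^sub>R x"
        using False by (simp add: u_def sgn_div_norm field_simps)
      then have "x + (e / 2) *\<^sub>R u = (1 + e / 2 / norm x) *\<^sub>R x"
        by (simp only: scaleR_add_left scaleR_one)
      then have "norm (x + (e / 2) *\<^sub>R u) = (1 + e / 2 / norm x) * norm x"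
        using e(1) by simp
      also have "\<dots> = norm x + e / 2" using False by (simp add: distrib_right)
      finally show ?thesis using e(1) by simp
    qed (use u e(1) in simp)
    ultimately show ?thesis by blast
  qed
  have lt: "norm x < r" if xE: "x \<in> E" for x
  proof -
    obtain y where y: "y \<in> E" "norm x < norm y" using ex[OF xE] by blast
    have "norm y \<le> r" unfolding r_def using y(1) by (intro cSup_upper[OF _ bdd]) simp
    then show ?thesis using y(2) by simp
  qed
  show "0 < r" using lt[OF assms(3)] by simp
  show "E = ball 0 r"
  proof (intro set_eqI iffI)
    fix x :: 'a assume "x \<in> ball 0 r"
    then have "norm x < Sup (norm ` E)" by (simp add: r_def)
    then obtain y where "y \<in> E" "norm x < norm y"
      using assms(3) by (subst (asm) less_cSup_iff) (auto simp: bdd)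
    then show "x \<in> E" using down[of y x] by simp
  qed (use lt in simp)
qed

text \<open>By coarea only the levels in \<open>{0..<1}\<close> count, and each superlevel set is a
  ball of radius at most \<open>c\<close>. The bound on \<open>s\<close> makes the perimeter of
  balls nondecreasing in the radius, so how the bump descends does not matter.\<close>

lemma seminorm_bump_le:
  fixes s :: real
  assumes c: "1 < c" and s: "s \<le> 2 * real DIM('a)"
  shows "seminorm s (bump (c\<^sup>2) :: 'a::euclidean_space \<Rightarrow> real)
    \<le> ennreal (c powr (2 * real DIM('a) - s)) * (2 * per s (ball (0::'a) 1))"
proof -
  let ?f = "bump (c\<^sup>2) :: 'a \<Rightarrow> real"
  let ?M = "ennreal (c powr (2 * real DIM('a) - s)) * (2 * per s (ball (0::'a) 1))"
  have c2: "1 < c\<^sup>2" using c by (simp add: one_less_power)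
  obtain D where "\<And>x. (?f has_derivative D x) (at x)" "\<And>v. smooth_fun (\<lambda>x. D x v)"
    by (rule smooth_fun_has_derivative[OF smooth_fun_bump[OF c2]]) (rule that)
  then have cont: "continuous_on UNIV ?f"
    by (auto intro!: continuous_at_imp_continuous_on has_derivative_continuous)
  then have [measurable]: "?f \<in> borel_measurable borel" by (rule borel_measurable_continuous_onI)
  have "seminorm s ?f = (\<integral>\<^sup>+t. 2 * per s {x. t < ?f x} \<partial>lborel)"
    by (rule seminorm_coarea) measurable
  also have "\<dots> \<le> (\<integral>\<^sup>+t. ?M * indicator {0..<1::real} t \<partial>lborel)"
  proof (rule nn_integral_mono)
    fix t :: real
    consider "t < 0" | "0 \<le> t" "t < 1" | "1 \<le> t" by linarith
    then show "2 * per s {x. t < ?f x} \<le> ?M * indicator {0..<1} t"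
    proof cases
      case 1
      then have "t < ?f x" for x using bump_nonneg[OF c2, of x] by linarith
      then have "{x. t < ?f x} = UNIV" by simp
      then show ?thesis by (simp add: per_def)
    next
      case 3
      then have "\<not> t < ?f x" for x using bump_le_1[OF c2, of x] by linarith
      then have "{x. t < ?f x} = {}" by simp
      then show ?thesis by (simp add: per_def)
    next
      case 2
      let ?E = "{x. t < ?f x}"
      have sub: "norm x < c" if "x \<in> ?E" for x
      proof (rule ccontr)
        assume "\<not> norm x < c"
        then have "c\<^sup>2 \<le> x \<bullet> x" using c by (simp add: power2_norm_eq_inner[symmetric])
        then show False using that 2 by (simp add: bump_eq_0)
      qed
      obtain r where r: "0 < r" "?E = ball 0 r"
      proof (rule open_radial_set_eq_ball[of ?E])
        show "open ?E" using cont by (intro open_Collect_less) auto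
        show "bounded ?E" using sub by (auto simp: bounded_iff intro: less_imp_le)
        show "0 \<in> ?E" using 2 bump_eq_1[of "0::'a", OF _ c2] by simp
        show "y \<in> ?E" if "x \<in> ?E" "norm y \<le> norm x" for x y
          using bump_antimono[OF c2 that(2)] that(1) by simp
      qed
      have "ball (0::'a) r \<subseteq> ball 0 c" using sub r by auto
      then have "r \<le> c" using r(1) by (simp add: ball_subset_ball_iff)
      then have "r powr (2 * real DIM('a) - s) \<le> c powr (2 * real DIM('a) - s)"
        using r s by (intro powr_mono2) auto
      then have "per s ?E \<le> ennreal (c powr (2 * real DIM('a) - s)) * per s (ball (0::'a) 1)"
        unfolding r(2) per_ball_scale[OF r(1)] by (intro mult_right_mono ennreal_leI) auto
      then have "2 * per s ?E \<le> 2 * (ennreal (c powr (2 * real DIM('a) - s)) * per s (ball (0::'a) 1))"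
        by (rule mult_left_mono) simp
      then show ?thesis using 2 by (simp add: mult.left_commute)
    qed
  qed
  also have "\<dots> = ?M" by (simp add: nn_integral_cmult_indicator)
  finally show ?thesis .
qed

subsection \<open>The three inequalities\<close>

text \<open>Division in \<open>ennreal\<close> is multiplication by \<open>inverse\<close>, so
  \<open>kern\<close> agrees with the original weight even at \<open>h = 0\<close>.\<close>

lemma frac_seminorm_eq: "frac_seminorm \<alpha> (f :: real^'n \<Rightarrow> real) = seminorm (real CARD('n) + \<alpha>) f"
  by (simp add: frac_seminorm_def seminorm_def kern_def divide_ennreal_def nn_integral_completion)

text \<open>On the diagonal real division gives \<open>1 / 0 = 0\<close> while \<open>kern\<close>
  is infinite there, but a point of \<open>E\<close> and a point of \<open>- E\<close> never
  coincide.\<close>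

lemma frac_perimeter_eq: "frac_perimeter \<alpha> (E :: (real^'n) set) = per (real CARD('n) + \<alpha>) E"
  unfolding frac_perimeter_def per_def nn_integral_completion
proof (rule nn_integral_cong)
  fix x :: "real^'n"
  let ?s = "real CARD('n) + \<alpha>"
  show "(\<integral>\<^sup>+y\<in>- E. ennreal (1 / norm (x - y) powr ?s) \<partial>lborel) * indicator E x
    = (\<integral>\<^sup>+y. indicator E x * indicator (- E) y * kern ?s (x - y) \<partial>lborel)"
  proof (cases "x \<in> E")
    case True
    have "(\<integral>\<^sup>+y\<in>- E. ennreal (1 / norm (x - y) powr ?s) \<partial>lborel) = (\<integral>\<^sup>+y. indicator (- E) y * kern ?s (x - y) \<partial>lborel)"
    proof (rule nn_integral_cong)
      fix y
      show "ennreal (1 / norm (x - y) powr ?s) * indicator (- E) y = indicator (- E) y * kern ?s (x - y)"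
      proof (cases "y \<in> E")
        case False
        then have "x \<noteq> y" using True by auto
        then show ?thesis by (simp add: kern_def inverse_ennreal inverse_eq_divide mult.commute)
      qed simp
    qed
    then show ?thesis using True by simp
  qed simp
qed

lemma continuous_on_test_function:
  assumes "f \<in> test_functions" shows "continuous_on UNIV f"
  using assms unfolding test_functions_def smooth_on_def by (auto dest: spec[of _ 0])

lemma test_function_powr_integrable:
  fixes f :: "real^'n \<Rightarrow> real"
  assumes f: "f \<in> test_functions" and p: "0 < p"
  shows "integrable lebesgue (\<lambda>x. \<bar>f x\<bar> powr p)"
proof -
  let ?K = "closure {x. f x \<noteq> 0}"
  have K: "compact ?K" using f by (simp add: test_functions_def)
  have cont: "continuous_on UNIV (\<lambda>x. \<bar>f x\<bar> powr p)"
    using p continuous_on_test_function[OF f] by (intro continuous_on_powr' continuous_intros) auto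
  then have "integrable lborel (\<lambda>x. indicator ?K x *\<^sub>R \<bar>f x\<bar> powr p)"
    using K by (intro borel_integrable_compact) (auto intro: continuous_on_subset)
  moreover have "(\<lambda>x. indicator ?K x *\<^sub>R \<bar>f x\<bar> powr p) = (\<lambda>x. \<bar>f x\<bar> powr p)"
    using closure_subset[of "{x. f x \<noteq> 0}"] by (auto simp: indicator_def fun_eq_iff)
  ultimately have "integrable lborel (\<lambda>x. \<bar>f x\<bar> powr p)" by (simp only:)
  then show ?thesis
    by (subst integrable_completion) (auto intro: borel_measurable_continuous_onI cont)
qed

text \<open>Chebyshev's inequality at level 1. It passes from the Sobolev to the isocapacitary
  inequality and bounds the norms of the bumps from below.\<close>

lemma measure_powr_le_Lp_norm:
  fixes f :: "real^'n \<Rightarrow> real"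
  assumes f: "f \<in> test_functions" "\<And>x. x \<in> U \<Longrightarrow> 1 \<le> f x" and p: "0 < p" and U: "open U" "bounded U"
  shows "measure lebesgue U powr (1 / p) \<le> Lp_norm p f"
proof -
  have Um: "U \<in> sets lborel" using U by simp
  have fin: "emeasure lebesgue U < \<infinity>" using U emeasure_bounded_finite[of U] by simp
  have "measure lebesgue U = (LINT x|lebesgue. indicator U x)"
    using U by simp
  also have "\<dots> \<le> (LINT x|lebesgue. \<bar>f x\<bar> powr p)"
  proof (rule integral_mono)
    show "integrable lebesgue (indicator U :: real^'n \<Rightarrow> real)"
      using Um fin by (intro integrable_real_indicator) auto
    show "integrable lebesgue (\<lambda>x. \<bar>f x\<bar> powr p)" by (rule test_function_powr_integrable[OF f(1) p])
    fix x :: "real^'n"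
    have "1 \<le> \<bar>f x\<bar> powr p" if "x \<in> U" using f(2)[OF that] p by (intro ge_one_powr_ge_zero) auto
    then show "indicator U x \<le> \<bar>f x\<bar> powr p" by (auto simp: indicator_def)
  qed
  finally show ?thesis
    unfolding Lp_norm_def using p by (intro powr_mono2) auto
qed

lemma measurable_per_level:
  fixes f :: "'a::euclidean_space \<Rightarrow> real"
  assumes [measurable]: "f \<in> borel_measurable borel"
  shows "(\<lambda>t. per s {x. t < f x}) \<in> borel_measurable borel"
proof -
  have "per s {x. t < f x} = (\<integral>\<^sup>+x. \<integral>\<^sup>+y. (if t < f x \<and> \<not> t < f y then 1 else 0) * kern s (x - y) \<partial>lborel \<partial>lborel)" for t
    unfolding per_def by (intro nn_integral_cong) (auto simp: indicator_def)
  moreover have "(\<lambda>t. \<integral>\<^sup>+x. \<integral>\<^sup>+y. (if t < f x \<and> \<not> t < f y then 1 else 0) * kern s (x - y) \<partial>lborel \<partial>lborel)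
    \<in> borel_measurable borel"
    by measurable
  ultimately show ?thesis by simp
qed

text \<open>Cavalieri and coarea: both sides are integrals over the levels \<open>t > 0\<close> of \<open>\<bar>f\<bar>\<close>.\<close>
lemma sobolev_of_isoperimetric:
  fixes f :: "real^'n \<Rightarrow> real"
  assumes f: "f \<in> test_functions" and p: "1 < p"
    and iso: "\<And>E :: (real^'n) set. E \<in> sets borel \<Longrightarrow> bounded E \<Longrightarrow>
      ennreal (measure lborel E powr (1 / p)) \<le> c * (2 * per s E)"
  shows "ennreal (Lp_norm p f) \<le> c * seminorm s f"
proof -
  let ?u = "\<lambda>x. \<bar>f x\<bar>"
  define I where "I = (LINT x|lebesgue. ?u x powr p)"
  have int: "integrable lebesgue (\<lambda>x. ?u x powr p)"
    using p by (intro test_function_powr_integrable[OF f]) auto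
  have [measurable]: "f \<in> borel_measurable borel"
    using continuous_on_test_function[OF f] by (rule borel_measurable_continuous_onI)
  have bdd: "bounded {x. t < ?u x}" if "0 < t" for t
  proof (rule bounded_subset)
    show "bounded (closure {x. f x \<noteq> 0})" using f by (simp add: test_functions_def compact_imp_bounded)
    show "{x. t < ?u x} \<subseteq> closure {x. f x \<noteq> 0}" using that closure_subset[of "{x. f x \<noteq> 0}"] by auto
  qed
  have meas: "{x. t < ?u x} \<in> sets borel" for t by measurable
  have "(\<integral>\<^sup>+x. ennreal (?u x powr p) \<partial>lborel) = ennreal I"
    using nn_integral_eq_integral[OF int] by (simp add: I_def nn_integral_completion)
  moreover have "0 \<le> I" by (simp add: I_def)
  ultimately have "ennreal (I powr (1 / p))
    \<le> (\<integral>\<^sup>+t. ennreal (measure lborel {x. t < ?u x} powr (1 / p)) * indicator {0<..} t \<partial>lborel)"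
    using p emeasure_bounded_finite[OF bdd]
    by (intro Lp_le_nn_integral_level_sets) auto
  also have "\<dots> \<le> (\<integral>\<^sup>+t. c * (2 * per s {x. t < ?u x}) \<partial>lborel)"
    using iso[OF meas bdd] by (intro nn_integral_mono) (auto simp: indicator_def)
  also have "\<dots> = c * seminorm s ?u"
    unfolding seminorm_coarea[OF borel_measurable_abs[OF \<open>f \<in> borel_measurable borel\<close>]]
    by (rule nn_integral_cmult) (auto intro!: borel_measurable_times_ennreal measurable_per_level)
  also have "\<dots> \<le> c * seminorm s f"
    by (intro mult_left_mono seminorm_abs_le) simp
  finally show ?thesis by (simp add: Lp_norm_def I_def)
qed

section \<open>The unit ball and the bumps as competitors for sharpness\<close>

lemma bump_test_function:
  assumes "1 < b" shows "(bump b :: real^'n \<Rightarrow> real) \<in> test_functions"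
proof -
  have "norm x \<le> b" if "bump b x \<noteq> 0" for x :: "real^'n"
  proof -
    have "norm x ^ 2 < b" using that bump_eq_0[of b x] by (force simp: power2_norm_eq_inner)
    also have "b \<le> b ^ 2" using assms by (simp add: power2_eq_square)
    finally have "norm x ^ 2 \<le> b ^ 2" by (rule less_imp_le)
    then show ?thesis by (rule power2_le_imp_le) (use assms in simp)
  qed
  then have "{x :: real^'n. bump b x \<noteq> 0} \<subseteq> cball 0 b" by auto
  then have "compact (closure {x :: real^'n. bump b x \<noteq> 0})"
    by (meson bounded_cball bounded_subset compact_closure)
  then show ?thesis
    using smooth_fun_imp_smooth_on[OF smooth_fun_bump[OF assms]] by (simp add: test_functions_def)
qed

lemma unit_ball_smooth_domain: "ball 0 1 \<in> (smooth_domains :: (real^'n) set set)"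
proof -
  define g :: "real^'n \<Rightarrow> real" where "g x = x \<bullet> x + (- 1)" for x
  have smooth: "smooth_on g S" for S
    unfolding g_def[abs_def] by (intro smooth_fun_imp_smooth_on smooth_fun.intros)
  have der: "frechet_derivative g (at x) = (\<lambda>v. 2 * (x \<bullet> v))" for x
  proof -
    have "(g has_derivative (\<lambda>v. 2 * (x \<bullet> v))) (at x)"
      unfolding g_def by (auto intro!: derivative_eq_intros simp: inner_commute)
    then show ?thesis by (rule frechet_derivative_at[symmetric])
  qed
  have "smooth_boundary (ball (0 :: real^'n) 1)"
    unfolding smooth_boundary_def
  proof (intro ballI exI conjI)
    fix p :: "real^'n" assume "p \<in> frontier (ball 0 1)"
    then have p: "norm p = 1" by (simp add: frontier_ball)
    \<comment> \<open>Radius 1 around a point of the unit sphere excludes the origin, the only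
      critical point of \<open>g\<close>.\<close>
    show "(0::real) < 1" by simp
    show "smooth_on g (ball p 1)" by (rule smooth)
    show "frechet_derivative g (at x) \<noteq> (\<lambda>v. 0)" if "x \<in> ball p 1" for x
    proof
      assume "frechet_derivative g (at x) = (\<lambda>v. 0)"
      then have "2 * (x \<bullet> x) = 0" unfolding der by (rule fun_cong)
      then show False using that p by simp
    qed
    show "ball 0 1 \<inter> ball p 1 = {x \<in> ball p 1. g x < 0}"
      by (auto simp: g_def dot_square_norm abs_square_less_1)
  qed
  then show ?thesis by (simp add: smooth_domains_def)
qed

lemma bump_ge_indicator_closure_ball:
  assumes "1 < b" shows "indicator (closure (ball 0 1)) x \<le> bump b (x :: real^'n)"
  using bump_eq_1[OF _ assms, of x] bump_nonneg[OF assms, of x] by (auto simp: indicator_def)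

text \<open>Let the width of the bumps shrink to \<open>0\<close>.\<close>
lemma constant_ge_of_bumps:
  assumes s: "s \<le> 2 * real CARD('n)" and P: "per s (ball (0 :: real^'n) 1) = ennreal P" "0 < P" and k: "0 \<le> k"
    and bound: "\<And>c. 1 < c \<Longrightarrow> ennreal W \<le> ennreal k * seminorm s (bump (c\<^sup>2) :: real^'n \<Rightarrow> real)"
  shows "W \<le> k * (2 * P)"
proof (rule ccontr)
  let ?e = "2 * real CARD('n) - s"
  assume "\<not> ?thesis"
  moreover have "((\<lambda>c. k * (2 * P) * c powr ?e) \<longlongrightarrow> k * (2 * P) * 1 powr ?e) (at_right 1)"
    by (intro tendsto_intros) auto
  ultimately have "\<forall>\<^sub>F c in at_right 1. k * (2 * P) * c powr ?e < W"
    by (intro order_tendstoD(2)) auto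
  moreover have "\<forall>\<^sub>F c in at_right (1::real). 1 < c"
    by (rule eventually_at_right_less)
  ultimately have "\<forall>\<^sub>F c in at_right 1. k * (2 * P) * c powr ?e < W \<and> 1 < c"
    by (rule eventually_conj)
  then obtain c where c: "k * (2 * P) * c powr ?e < W" "1 < c"
    using eventually_happens[of _ "at_right (1::real)"] by auto
  have "ennreal W \<le> ennreal k * (ennreal (c powr ?e) * (2 * ennreal P))"
    using order_trans[OF bound[OF c(2)] mult_left_mono[OF seminorm_bump_le[OF c(2)]]] s P(1) by simp
  also have "\<dots> = ennreal (k * (2 * P) * c powr ?e)"
    using k P(2) by (simp add: ennreal_mult mult_ac)
  finally have "W \<le> k * (2 * P) * c powr ?e"
    using k P(2) by (simp add: ennreal_le_iff)
  then show False using c(1) by simp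
qed

theorem theorem4:
  fixes \<alpha> :: real
  assumes "0 < \<alpha>" and "\<alpha> < 1"
  shows "(optimal_constant (sobolev_ineq TYPE('n::finite) \<alpha>) (kappa TYPE('n) \<alpha>)
            \<longleftrightarrow> optimal_constant (isocapacitary_ineq TYPE('n) \<alpha>) (kappa TYPE('n) \<alpha>)) \<and>
         (optimal_constant (isocapacitary_ineq TYPE('n) \<alpha>) (kappa TYPE('n) \<alpha>)
            \<longleftrightarrow> optimal_constant (isoperimetric_ineq TYPE('n) \<alpha>) (2 * kappa TYPE('n) \<alpha>))"
proof -
  let ?n = "real CARD('n)"
  let ?B = "ball 0 1 :: (real^'n) set"
  let ?e = "(?n - \<alpha>) / ?n"
  have n: "1 \<le> ?n" by (simp add: Suc_leI)
  have n\<alpha>: "0 < ?n - \<alpha>" using assms n by linarith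
  define s where "s = ?n + \<alpha>"
  define p where "p = ?n / (?n - \<alpha>)"
  define \<omega> where "\<omega> = unit_ball_vol ?n"
  define W where "W = \<omega> powr ?e"
  have p: "1 < p" "1 / p = ?e" using assms n\<alpha> by (simp_all add: p_def less_divide_eq)
  have \<omega>: "0 < \<omega>" "measure lebesgue ?B = \<omega>" by (simp_all add: \<omega>_def content_ball)
  have W: "0 < W" using \<omega> by (simp add: W_def)
  define P where "P = enn2real (per s ?B)"
  have "0 < per s ?B" "per s ?B < top"
    using assms n by (auto simp: s_def intro!: per_ball_pos per_ball_finite)
  then have P: "per s ?B = ennreal P" "0 < P"
    by (simp_all add: P_def enn2real_positive_iff)
  define k where "k = W / (2 * P)"
  have k: "0 < k" using W P by (simp add: k_def)
  have kappa: "kappa TYPE('n) \<alpha> = ennreal k"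
  proof -
    have "2 * ennreal P = ennreal (2 * P)" using P(2) by (simp add: ennreal_mult)
    then show ?thesis
      using P W \<omega>(2) unfolding kappa_def frac_perimeter_eq
      by (simp add: s_def[symmetric] W_def[symmetric] k_def divide_ennreal)
  qed
  have iso: "ennreal (measure lborel E powr (1 / p)) \<le> ennreal k * (2 * per s E)"
    if "E \<in> sets borel" "bounded E" for E :: "(real^'n) set"
  proof -
    have "ennreal W / ennreal P = ennreal k * 2"
    proof -
      have "ennreal k * 2 = ennreal (k * 2)" using k by (simp add: ennreal_mult)
      then show ?thesis using P W by (simp add: divide_ennreal k_def)
    qed
    then show ?thesis
      using fractional_isoperimetric[OF that assms] P(1) unfolding p(2)
      by (simp add: s_def[symmetric] W_def[symmetric] \<omega>_def[symmetric] mult.assoc)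
  qed
  have sob: "ennreal (Lp_norm p f) \<le> ennreal k * frac_seminorm \<alpha> f"
    if "f \<in> test_functions" for f :: "real^'n \<Rightarrow> real"
    unfolding frac_seminorm_eq using sobolev_of_isoperimetric[OF that p(1) iso] by (simp add: s_def)
  have dom: "open U" "bounded U" "measure lebesgue U = measure lborel U" if "U \<in> smooth_domains" for U :: "(real^'n) set"
    using that by (auto simp: smooth_domains_def)
  have s2: "s \<le> 2 * ?n" unfolding s_def using assms n by linarith
  have c2: "1 < c\<^sup>2" if "1 < c" for c :: real using that by (simp add: one_less_power)
  have bump: "bump (c\<^sup>2) \<in> (test_functions :: (real^'n \<Rightarrow> real) set)" if "1 < c" for c :: real
    by (rule bump_test_function[OF c2[OF that]])
  \<comment> \<open>Shared by (i) and (ii): a constant that works on all bumps with \<open>W\<close>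
    on the left is at least \<open>k\<close>.\<close>
  have lower: "k \<le> k'" if "0 \<le> k'" "\<And>c. 1 < c \<Longrightarrow> ennreal W \<le> ennreal k' * frac_seminorm \<alpha> (bump (c\<^sup>2) :: real^'n \<Rightarrow> real)" for k'
  proof -
    have "W \<le> k' * (2 * P)"
      using that(2) by (intro constant_ge_of_bumps[OF s2 P that(1)]) (simp add: frac_seminorm_eq s_def)
    then show ?thesis using P by (simp add: k_def pos_divide_le_eq)
  qed
  have sobolev: "optimal_constant (sobolev_ineq TYPE('n) \<alpha>) (kappa TYPE('n) \<alpha>)"
    unfolding optimal_constant_def kappa
  proof (intro conjI allI impI notI)
    show "sobolev_ineq TYPE('n) \<alpha> (ennreal k)"
      using sob by (simp add: sobolev_ineq_def p_def)
    fix c' assume c': "c' < ennreal k" and "sobolev_ineq TYPE('n) \<alpha> c'"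
    then have sob': "ennreal (Lp_norm p f) \<le> c' * frac_seminorm \<alpha> f" if "f \<in> test_functions" for f :: "real^'n \<Rightarrow> real"
      using that by (simp add: sobolev_ineq_def p_def)
    obtain k' where k': "c' = ennreal k'" "0 \<le> k'" using c' by (cases c') auto
    have "k \<le> k'"
    proof (rule lower[OF k'(2)])
      fix c :: real assume c: "1 < c"
      have "1 \<le> bump (c\<^sup>2) x" if "x \<in> ?B" for x
        using bump_eq_1[OF _ c2[OF c], of x] that by simp
      then have "W \<le> Lp_norm p (bump (c\<^sup>2) :: real^'n \<Rightarrow> real)"
        using measure_powr_le_Lp_norm[OF bump[OF c], of ?B p] p \<omega> by (simp add: W_def)
      then show "ennreal W \<le> ennreal k' * frac_seminorm \<alpha> (bump (c\<^sup>2) :: real^'n \<Rightarrow> real)"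
        using sob'[OF bump[OF c]] unfolding k'(1) by (meson ennreal_leI order_trans)
    qed
    then show False using c' k' by (simp add: ennreal_less_iff)
  qed

  have isocapacitary: "optimal_constant (isocapacitary_ineq TYPE('n) \<alpha>) (kappa TYPE('n) \<alpha>)"
    unfolding optimal_constant_def kappa
  proof (intro conjI allI impI notI)
    show "isocapacitary_ineq TYPE('n) \<alpha> (ennreal k)"
      unfolding isocapacitary_ineq_def
    proof
      fix U :: "(real^'n) set" assume U: "U \<in> smooth_domains"
      \<comment> \<open>With \<open>k\<close> on the left, one number bounds the seminorm of every
        competitor from below, so the bound passes to the infimum.\<close>
      have "ennreal (1 / k) * ennreal (measure lebesgue U powr ?e) \<le> frac_capacity \<alpha> (closure U)"
        unfolding frac_capacity_def
      proof (rule Inf_greatest, clarify)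
        fix f :: "real^'n \<Rightarrow> real" assume f: "f \<in> test_functions" "\<forall>x. indicator (closure U) x \<le> f x"
        have "1 \<le> f x" if "x \<in> U" for x
          using f(2)[rule_format, of x] that closure_subset[of U] by (auto simp: indicator_def split: if_splits)
        then have "measure lebesgue U powr (1 / p) \<le> Lp_norm p f"
          using p dom[OF U] by (intro measure_powr_le_Lp_norm[OF f(1)]) auto
        then have "ennreal (measure lebesgue U powr ?e) \<le> ennreal k * frac_seminorm \<alpha> f"
          unfolding p(2) using sob[OF f(1)] by (meson ennreal_leI order_trans)
        then have "ennreal (1 / k) * ennreal (measure lebesgue U powr ?e) \<le> ennreal (1 / k) * (ennreal k * frac_seminorm \<alpha> f)"
          by (rule mult_left_mono) simp
        also have "\<dots> = frac_seminorm \<alpha> f"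
          using k by (simp add: mult.assoc[symmetric] ennreal_mult[symmetric])
        finally show "ennreal (1 / k) * ennreal (measure lebesgue U powr ?e) \<le> frac_seminorm \<alpha> f" .
      qed
      then have "ennreal k * (ennreal (1 / k) * ennreal (measure lebesgue U powr ?e)) \<le> ennreal k * frac_capacity \<alpha> (closure U)"
        by (rule mult_left_mono) simp
      then show "ennreal (measure lebesgue U powr ?e) \<le> ennreal k * frac_capacity \<alpha> (closure U)"
        using k by (simp add: mult.assoc[symmetric] ennreal_mult[symmetric])
    qed
    fix c' assume c': "c' < ennreal k" and "isocapacitary_ineq TYPE('n) \<alpha> c'"
    then have cap: "ennreal W \<le> c' * frac_capacity \<alpha> (closure ?B)"
      using unit_ball_smooth_domain \<omega>(2) unfolding isocapacitary_ineq_def W_def by metis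
    obtain k' where k': "c' = ennreal k'" "0 \<le> k'" using c' by (cases c') auto
    have "k \<le> k'"
    proof (rule lower[OF k'(2)])
      fix c :: real assume c: "1 < c"
      have "frac_capacity \<alpha> (closure ?B) \<le> frac_seminorm \<alpha> (bump (c\<^sup>2) :: real^'n \<Rightarrow> real)"
        unfolding frac_capacity_def
        using bump[OF c] bump_ge_indicator_closure_ball[OF c2[OF c]] by (intro Inf_lower) blast
      then show "ennreal W \<le> ennreal k' * frac_seminorm \<alpha> (bump (c\<^sup>2) :: real^'n \<Rightarrow> real)"
        using cap unfolding k'(1) by (meson mult_left_mono order_trans zero_le)
    qed
    then show False using c' k' by (simp add: ennreal_less_iff)
  qed

  have two_kappa: "2 * kappa TYPE('n) \<alpha> = ennreal (2 * k)"
    using k by (simp add: kappa ennreal_mult)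
  have isoperimetric: "optimal_constant (isoperimetric_ineq TYPE('n) \<alpha>) (2 * kappa TYPE('n) \<alpha>)"
    unfolding optimal_constant_def two_kappa
  proof (intro conjI allI impI notI)
    show "isoperimetric_ineq TYPE('n) \<alpha> (ennreal (2 * k))"
      unfolding isoperimetric_ineq_def
    proof
      fix U :: "(real^'n) set" assume U: "U \<in> smooth_domains"
      have "ennreal k * (2 * per s U) = ennreal (2 * k) * per s U"
        using k by (simp add: ennreal_mult mult_ac)
      then show "ennreal (measure lebesgue U powr ?e) \<le> ennreal (2 * k) * frac_perimeter \<alpha> U"
        using iso[of U] dom[OF U] unfolding p(2) frac_perimeter_eq by (simp add: s_def)
    qed
    \<comment> \<open>The unit ball is an admissible domain and gives equality in (iii), since
      \<open>W = 2 * k * P\<close>; testing on it replaces approximation by bumps.\<close>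
    fix c' assume c': "c' < ennreal (2 * k)" and "isoperimetric_ineq TYPE('n) \<alpha> c'"
    then have le: "ennreal W \<le> c' * per s ?B"
      using unit_ball_smooth_domain \<omega>(2) unfolding isoperimetric_ineq_def W_def s_def frac_perimeter_eq by metis
    obtain k' where k': "c' = ennreal k'" "0 \<le> k'" using c' by (cases c') auto
    have "ennreal W \<le> ennreal (k' * P)"
      using le k' P by (simp add: ennreal_mult)
    then have "W \<le> k' * P" using k' P by (simp add: ennreal_le_iff)
    then show False using c' k' P by (simp add: ennreal_less_iff k_def field_simps)
  qed

  show ?thesis using sobolev isocapacitary isoperimetric by simp
qed

end
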